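(* Let $\mathcal{V}$ be a strongly irregular variety of a plural type (possibly with constants), let $\mathbb{A}=(\{\mathbf{A}_i\}_{i\in I},(I,\le),\{p_{ij}\}_{i\le j})$ be a semilattice direct system of algebras in $\mathcal{V}$ and let $\mathbf{A}$ be its P\l onka sum. Then the lattices $Con(\mathbf{A})$ and $Con(\mathbb{A})$ are isomorphic. More precisely: (1) if $\theta\in Con(\mathbf{A})$, then $(C_\theta,\{\theta_{ii}\}_{i\in I})$ is a congruence on $\mathbb{A}$; (2) if $(C,\{\theta_{ii}\}_{i\in I})$ is a congruence on $\mathbb{A}$ and one sets $\theta_{ij}:=(p_{i,i\vee j}\times p_{j,i\vee j})^{-1}(\theta_{i\vee j,i\vee j})$ for every $(i,j)\in S_C$ with $i\ne j$, then $\theta:=\bigcup_{(i,j)\in S_C}\theta_{ij}$ is a congruence on $\mathbf{A}$; (3) the constructions in (1) and (2) define mutually inverse lattice isomorphisms.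
   Context: A type is plural if it contains at least one operation symbol of arity at least $2$. A variety $\mathcal{V}$ is strongly irregular if there is a binary term $f(x,y)$, in which both variables actually occur, such that $\mathcal{V}\models f(x,y)\approx x$. A semilattice direct system $\mathbb{A}=(\{\mathbf{A}_i\}_{i\in I},(I,\le),\{p_{ij}\}_{i\le j})$ consists of a join-semilattice $\mathbf{I}=(I,\le)$ with join $\vee$ (required to have a least element $i_0$ when the type contains constants), algebras $\mathbf{A}_i$ of the same type with pairwise disjoint universes, and homomorphisms $p_{ij}\colon\mathbf{A}_i\to\mathbf{A}_j$ for $i\le j$ with $p_{ii}=\mathrm{id}$ and $p_{ik}=p_{jk}\circ p_{ij}$ for $i\le j\le k$. Its P\l onka sum is the algebra with universe $\bigcup_{i\in I}A_i$ in which, for every $n$-ary operation $g$ with $n\ge1$ and $a_1\in A_{i_1},\dots,a_n\in A_{i_n}$, $g(a_1,\dots,a_n)=g^{\mathbf{A}_j}(p_{i_1j}(a_1),\dots,p_{i_nj}(a_n))$ with $j=i_1\vee\dots\vee i_n$, and every constant $c$ is interpreted as $c^{\mathbf{A}_{i_0}}$. For $\theta\in Con(\mathbf{A})$: $\theta_{ij}:=\theta\cap(A_i\times A_j)$; $S_\theta:=\{(i,j)\in I\times I\mid\theta_{ij}\neq\emptyset\}$; $C_\theta:=\{(i,j)\in I\times I\mid (i,i\vee j),(j,i\vee j)\in S_\theta\}$. Given $C\in Con(\mathbf{I})$ and a family $\theta_{ii}\in Con(\mathbf{A}_i)$ ($i\in I$), let $S_C:=\{(i,j)\in C\mid (p_{i,i\vee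 j}\times p_{j,i\vee j})^{-1}(\theta_{i\vee j,i\vee j})\ne\emptyset\}$, where $(p\times q)(a,b)=(p(a),q(b))$. A congruence on $\mathbb{A}$ is a pair $(C,\{\theta_{ii}\}_{i\in I})$ such that: (i) $C\in Con(\mathbf{I})$; (ii) $\theta_{ii}\in Con(\mathbf{A}_i)$ for every $i\in I$; (iii) $\theta_{ii}\subseteq(p_{i,i\vee j}\times p_{i,i\vee j})^{-1}(\theta_{i\vee j,i\vee j})$ for all $i,j\in I$; (iv) $\theta_{ii}=(p_{i,i\vee j}\times p_{i,i\vee j})^{-1}(\theta_{i\vee j,i\vee j})$ for all $(i,j)\in S_C$. $Con(\mathbb{A})$ is the set of congruences on $\mathbb{A}$, ordered by $(C,\{\theta_{ii}\})\le(C',\{\theta'_{ii}\})$ iff $C\subseteq C'$ and $\theta_{ii}\subseteq\theta'_{ii}$ for all $i\in I$. *)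

theory Defs
  imports "HOL-Algebra.Lattice"
begin

section \<open>Algebras, terms and varieties\<close>

text \<open>
  A type (signature) is a function \<open>ar :: 'f \<Rightarrow> nat\<close> giving each operation symbol its arity; symbols
  of arity 0 are the constants. An operation takes its arguments as a list, and its values on lists
  of the wrong length, or with entries outside the carrier, are irrelevant.
\<close>

record ('a, 'f) algebra = "'a partial_object" +
  oper :: "'f \<Rightarrow> 'a list \<Rightarrow> 'a"

text \<open>Universes of algebras are non-empty.\<close>

definition is_algebra :: "('f \<Rightarrow> nat) \<Rightarrow> ('a, 'f) algebra \<Rightarrow> bool" where
  "is_algebra ar A \<longleftrightarrow> carrier A \<noteq> {} \<and>
     (\<forall>g as. set as \<subseteq> carrier A \<and> length as = ar g \<longrightarrow> oper A g as \<in> carrier A)"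

definition algebra_hom ::
    "('f \<Rightarrow> nat) \<Rightarrow> ('a, 'f) algebra \<Rightarrow> ('b, 'f) algebra \<Rightarrow> ('a \<Rightarrow> 'b) set" where
  "algebra_hom ar A B = {h. h \<in> carrier A \<rightarrow> carrier B \<and>
     (\<forall>g as. set as \<subseteq> carrier A \<and> length as = ar g \<longrightarrow>
        h (oper A g as) = oper B g (map h as))}"

definition congruences :: "('f \<Rightarrow> nat) \<Rightarrow> ('a, 'f) algebra \<Rightarrow> ('a \<times> 'a) set set" where
  "congruences ar A = {\<theta>. equiv (carrier A) \<theta> \<and>
     (\<forall>g as bs. length as = ar g \<and> list_all2 (\<lambda>a b. (a, b) \<in> \<theta>) as bs \<longrightarrow>
        (oper A g as, oper A g bs) \<in> \<theta>)}"

datatype 'f trm = Var nat | Fn 'f "'f trm list"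

fun vars :: "'f trm \<Rightarrow> nat set" where
  "vars (Var x) = {x}"
| "vars (Fn g ts) = (\<Union>t \<in> set ts. vars t)"

fun wf_trm :: "('f \<Rightarrow> nat) \<Rightarrow> 'f trm \<Rightarrow> bool" where
  "wf_trm ar (Var x) \<longleftrightarrow> True"
| "wf_trm ar (Fn g ts) \<longleftrightarrow> length ts = ar g \<and> (\<forall>t \<in> set ts. wf_trm ar t)"

primrec eval_trm :: "('a, 'f) algebra \<Rightarrow> (nat \<Rightarrow> 'a) \<Rightarrow> 'f trm \<Rightarrow> 'a" where
  "eval_trm A v (Var x) = v x"
| "eval_trm A v (Fn g ts) = oper A g (map (eval_trm A v) ts)"

definition satisfies :: "('a, 'f) algebra \<Rightarrow> 'f trm \<Rightarrow> 'f trm \<Rightarrow> bool" where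
  "satisfies A s t \<longleftrightarrow> (\<forall>v. range v \<subseteq> carrier A \<longrightarrow> eval_trm A v s = eval_trm A v t)"

text \<open>
  A variety is the class of all algebras satisfying some set of identities; here it is represented
  by its members whose universe is a set of elements of \<open>'a\<close>. Hence in \<open>strongly_irregular\<close>
  below, only these members are required to satisfy the identity.
\<close>

definition variety :: "('f \<Rightarrow> nat) \<Rightarrow> ('a, 'f) algebra set \<Rightarrow> bool" where
  "variety ar V \<longleftrightarrow> (\<exists>E. (\<forall>(s, t) \<in> E. wf_trm ar s \<and> wf_trm ar t) \<and>
     V = {A. is_algebra ar A \<and> (\<forall>(s, t) \<in> E. satisfies A s t)})"

definition plural :: "('f \<Rightarrow> nat) \<Rightarrow> bool" where
  "plural ar \<longleftrightarrow> (\<exists>g. ar g \<ge> 2)"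

definition strongly_irregular :: "('f \<Rightarrow> nat) \<Rightarrow> ('a, 'f) algebra set \<Rightarrow> bool" where
  "strongly_irregular ar V \<longleftrightarrow>
     (\<exists>t. wf_trm ar t \<and> vars t = {0, 1} \<and> (\<forall>A \<in> V. satisfies A t (Var 0)))"


section \<open>Semilattice direct systems and Plonka sums\<close>

definition semilattice_direct_system ::
    "('f \<Rightarrow> nat) \<Rightarrow> 'i gorder \<Rightarrow> ('i \<Rightarrow> ('a, 'f) algebra) \<Rightarrow> ('i \<Rightarrow> 'i \<Rightarrow> 'a \<Rightarrow> 'a) \<Rightarrow> bool" where
  "semilattice_direct_system ar I A p \<longleftrightarrow>
     upper_semilattice I \<and> carrier I \<noteq> {} \<and>
     ((\<exists>c. ar c = 0) \<longrightarrow> (\<exists>i0. least I i0 (carrier I))) \<and>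
     (\<forall>i \<in> carrier I. is_algebra ar (A i)) \<and>
     (\<forall>i \<in> carrier I. \<forall>j \<in> carrier I. i \<noteq> j \<longrightarrow> carrier (A i) \<inter> carrier (A j) = {}) \<and>
     (\<forall>i \<in> carrier I. \<forall>j \<in> carrier I. i \<sqsubseteq>\<^bsub>I\<^esub> j \<longrightarrow> p i j \<in> algebra_hom ar (A i) (A j)) \<and>
     (\<forall>i \<in> carrier I. \<forall>a \<in> carrier (A i). p i i a = a) \<and>
     (\<forall>i \<in> carrier I. \<forall>j \<in> carrier I. \<forall>k \<in> carrier I. i \<sqsubseteq>\<^bsub>I\<^esub> j \<and> j \<sqsubseteq>\<^bsub>I\<^esub> k \<longrightarrow>
        (\<forall>a \<in> carrier (A i). p i k a = p j k (p i j a)))"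

definition index_of :: "'i gorder \<Rightarrow> ('i \<Rightarrow> ('a, 'f) algebra) \<Rightarrow> 'a \<Rightarrow> 'i" where
  "index_of I A a = (THE i. i \<in> carrier I \<and> a \<in> carrier (A i))"

text \<open>The empty argument list is that of the constants.\<close>

definition plonka_sum ::
    "'i gorder \<Rightarrow> ('i \<Rightarrow> ('a, 'f) algebra) \<Rightarrow> ('i \<Rightarrow> 'i \<Rightarrow> 'a \<Rightarrow> 'a) \<Rightarrow> ('a, 'f) algebra" where
  "plonka_sum I A p = \<lparr>
     carrier = (\<Union>i \<in> carrier I. carrier (A i)),
     oper = (\<lambda>g as.
       if as = [] then oper (A \<bottom>\<^bsub>I\<^esub>) g []
       else let j = \<Squnion>\<^bsub>I\<^esub> (index_of I A ` set as)
            in oper (A j) g (map (\<lambda>a. p (index_of I A a) j a) as)) \<rparr>"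


section \<open>Congruences of the index semilattice and of the system\<close>

definition join_congruences :: "'i gorder \<Rightarrow> ('i \<times> 'i) set set" where
  "join_congruences I = {C. equiv (carrier I) C \<and>
     (\<forall>i j k l. (i, j) \<in> C \<and> (k, l) \<in> C \<longrightarrow> (i \<squnion>\<^bsub>I\<^esub> k, j \<squnion>\<^bsub>I\<^esub> l) \<in> C)}"

text \<open>\<open>pullback A p i j k R\<close> is the preimage \<open>(p i k \<times> p j k)\<^sup>-\<^sup>1(R)\<close>, a subset of \<open>A i \<times> A j\<close>.\<close>

definition pullback ::
    "('i \<Rightarrow> ('a, 'f) algebra) \<Rightarrow> ('i \<Rightarrow> 'i \<Rightarrow> 'a \<Rightarrow> 'a) \<Rightarrow> 'i \<Rightarrow> 'i \<Rightarrow> 'i \<Rightarrow> ('a \<times> 'a) set \<Rightarrow> ('a \<times> 'a) set" where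
  "pullback A p i j k R =
     (map_prod (p i k) (p j k) -` R) \<inter> (carrier (A i) \<times> carrier (A j))"

definition S_of :: "'i gorder \<Rightarrow> ('i \<Rightarrow> ('a, 'f) algebra) \<Rightarrow> ('i \<Rightarrow> 'i \<Rightarrow> 'a \<Rightarrow> 'a) \<Rightarrow>
    ('i \<times> 'i) set \<Rightarrow> ('i \<Rightarrow> ('a \<times> 'a) set) \<Rightarrow> ('i \<times> 'i) set" where
  "S_of I A p C T = {(i, j) \<in> C. pullback A p i j (i \<squnion>\<^bsub>I\<^esub> j) (T (i \<squnion>\<^bsub>I\<^esub> j)) \<noteq> {}}"

text \<open>
  A family \<open>(\<theta>\<^sub>i\<^sub>i)\<close> is a function \<open>T\<close> with \<open>T i = \<theta>\<^sub>i\<^sub>i\<close>, extensional (\<open>undefined\<close> off the index set)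
  so that equal families are equal functions.
\<close>

definition system_congruences :: "('f \<Rightarrow> nat) \<Rightarrow> 'i gorder \<Rightarrow> ('i \<Rightarrow> ('a, 'f) algebra) \<Rightarrow>
    ('i \<Rightarrow> 'i \<Rightarrow> 'a \<Rightarrow> 'a) \<Rightarrow> (('i \<times> 'i) set \<times> ('i \<Rightarrow> ('a \<times> 'a) set)) set" where
  "system_congruences ar I A p = {(C, T).
     C \<in> join_congruences I \<and>
     T \<in> extensional (carrier I) \<and>
     (\<forall>i \<in> carrier I. T i \<in> congruences ar (A i)) \<and>
     (\<forall>i \<in> carrier I. \<forall>j \<in> carrier I.
        T i \<subseteq> pullback A p i i (i \<squnion>\<^bsub>I\<^esub> j) (T (i \<squnion>\<^bsub>I\<^esub> j))) \<and>
     (\<forall>(i, j) \<in> S_of I A p C T.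
        T i = pullback A p i i (i \<squnion>\<^bsub>I\<^esub> j) (T (i \<squnion>\<^bsub>I\<^esub> j)))}"


section \<open>The two lattices and the maps between them\<close>

definition Con_algebra :: "('f \<Rightarrow> nat) \<Rightarrow> ('a, 'f) algebra \<Rightarrow> ('a \<times> 'a) set gorder" where
  "Con_algebra ar A = \<lparr> carrier = congruences ar A, eq = (=), le = (\<subseteq>) \<rparr>"

definition Con_system :: "('f \<Rightarrow> nat) \<Rightarrow> 'i gorder \<Rightarrow> ('i \<Rightarrow> ('a, 'f) algebra) \<Rightarrow>
    ('i \<Rightarrow> 'i \<Rightarrow> 'a \<Rightarrow> 'a) \<Rightarrow> (('i \<times> 'i) set \<times> ('i \<Rightarrow> ('a \<times> 'a) set)) gorder" where
  "Con_system ar I A p = \<lparr> carrier = system_congruences ar I A p, eq = (=),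
     le = (\<lambda>(C, T) (C', T'). C \<subseteq> C' \<and> (\<forall>i \<in> carrier I. T i \<subseteq> T' i)) \<rparr>"

definition lattice_isos :: "'x gorder \<Rightarrow> 'y gorder \<Rightarrow> ('x \<Rightarrow> 'y) set" where
  "lattice_isos L M =
     {h. bij_betw h (carrier L) (carrier M) \<and> join_pres L M h \<and> meet_pres L M h}"

definition component ::
    "('i \<Rightarrow> ('a, 'f) algebra) \<Rightarrow> ('a \<times> 'a) set \<Rightarrow> 'i \<Rightarrow> 'i \<Rightarrow> ('a \<times> 'a) set" where
  "component A \<theta> i j = \<theta> \<inter> (carrier (A i) \<times> carrier (A j))"

definition S_theta ::
    "'i gorder \<Rightarrow> ('i \<Rightarrow> ('a, 'f) algebra) \<Rightarrow> ('a \<times> 'a) set \<Rightarrow> ('i \<times> 'i) set" where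
  "S_theta I A \<theta> = {(i, j) \<in> carrier I \<times> carrier I. component A \<theta> i j \<noteq> {}}"

definition C_theta ::
    "'i gorder \<Rightarrow> ('i \<Rightarrow> ('a, 'f) algebra) \<Rightarrow> ('a \<times> 'a) set \<Rightarrow> ('i \<times> 'i) set" where
  "C_theta I A \<theta> = {(i, j) \<in> carrier I \<times> carrier I.
     (i, i \<squnion>\<^bsub>I\<^esub> j) \<in> S_theta I A \<theta> \<and> (j, i \<squnion>\<^bsub>I\<^esub> j) \<in> S_theta I A \<theta>}"

definition to_system :: "'i gorder \<Rightarrow> ('i \<Rightarrow> ('a, 'f) algebra) \<Rightarrow> ('a \<times> 'a) set \<Rightarrow>
    ('i \<times> 'i) set \<times> ('i \<Rightarrow> ('a \<times> 'a) set)" where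
  "to_system I A \<theta> = (C_theta I A \<theta>, \<lambda>i \<in> carrier I. component A \<theta> i i)"

definition from_system :: "'i gorder \<Rightarrow> ('i \<Rightarrow> ('a, 'f) algebra) \<Rightarrow> ('i \<Rightarrow> 'i \<Rightarrow> 'a \<Rightarrow> 'a) \<Rightarrow>
    ('i \<times> 'i) set \<times> ('i \<Rightarrow> ('a \<times> 'a) set) \<Rightarrow> ('a \<times> 'a) set" where
  "from_system I A p = (\<lambda>(C, T). \<Union>(i, j) \<in> S_of I A p C T.
     if i = j then T i else pullback A p i j (i \<squnion>\<^bsub>I\<^esub> j) (T (i \<squnion>\<^bsub>I\<^esub> j)))"

end

(* Strong irregularity supplies a term t(x, y) that is the first projection in every summand, so on
   the Plonka sum t(a, b) moves a in A_i to the join of i and the index of b. Hence a congruence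
   theta of the sum that relates some element of A_i to some element of A_m, where i <= m, relates
   every a in A_i to p_im(a): for c theta d with c in A_i and d in A_m,
   a = t(a, c) theta t(a, d) = p_im(a). So theta is determined by the pairs (i, m) at which this
   happens and by its restrictions to the summands. *)

theory Submission
  imports Defs "HOL-Algebra.Complete_Lattice"
begin

section \<open>Lattices of congruences and lattice isomorphisms\<close>

text \<open>Both directions struggle with joins. The relation built from a pair
  \<open>(C, T)\<close> compares \<open>a\<close> and \<open>c\<close> at the join of their two
  indices, but a middle element \<open>b\<close> relates them only at the join of all three indices;
  condition (iv) is what brings the relation down again. Conversely, \<open>C_theta\<close> tests
  two indices at their join only, while composing two such tests yields links to some larger common
  upper bound. The remedy is that the linked pairs \<open>i \<sqsubseteq> m\<close> are closed under
  composition, under joining both sides with a fixed index, and under lowering \<open>m\<close>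
  towards \<open>i\<close>. The last two follow by applying \<open>t\<close> with well-chosen second
  arguments, which moves one entry of a related pair and holds the other in place. The lattice
  structure on the sum's congruences comes from intersections and is carried to the pairs
  \<open>(C, T)\<close> along the bijection, which preserves and reflects the order.\<close>

lemma order_iso_in_lattice_isos:
  assumes "lattice L" "lattice M"
    and h: "h \<in> carrier L \<rightarrow> carrier M" and k: "k \<in> carrier M \<rightarrow> carrier L"
    and kh: "\<And>x. x \<in> carrier L \<Longrightarrow> k (h x) = x" and hk: "\<And>y. y \<in> carrier M \<Longrightarrow> h (k y) = y"
    and mono: "\<And>x y. x \<in> carrier L \<Longrightarrow> y \<in> carrier L \<Longrightarrow> x \<sqsubseteq>\<^bsub>L\<^esub> y \<longleftrightarrow> h x \<sqsubseteq>\<^bsub>M\<^esub> h y"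
  shows "h \<in> lattice_isos L M"
proof -
  interpret L: lattice L by fact
  interpret M: lattice M by fact
  have hc: "\<And>x. x \<in> carrier L \<Longrightarrow> h x \<in> carrier M"
    and kc: "\<And>x. x \<in> carrier M \<Longrightarrow> k x \<in> carrier L" using h k by auto
  \<comment> \<open>\<open>k\<close> is adjoint to \<open>h\<close> on both sides.
    \<open>mono''\<close> pulls upper bounds back to \<open>L\<close> and gives joins;
    \<open>mono'\<close> pulls back lower bounds and gives meets.\<close>
  have mono': "k x \<sqsubseteq>\<^bsub>L\<^esub> y" if "x \<in> carrier M" "y \<in> carrier L" "x \<sqsubseteq>\<^bsub>M\<^esub> h y" for x y
    using mono[of "k x" y] that kc hk by auto
  have mono'': "y \<sqsubseteq>\<^bsub>L\<^esub> k x" if "x \<in> carrier M" "y \<in> carrier L" "h y \<sqsubseteq>\<^bsub>M\<^esub> x" for x y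
    using mono[of y "k x"] that kc hk by auto
  have "h (x \<squnion>\<^bsub>L\<^esub> y) = h x \<squnion>\<^bsub>M\<^esub> h y" if xy: "x \<in> carrier L" "y \<in> carrier L" for x y
  proof (rule M.le_antisym)
    have "x \<sqsubseteq>\<^bsub>L\<^esub> k (h x \<squnion>\<^bsub>M\<^esub> h y)" "y \<sqsubseteq>\<^bsub>L\<^esub> k (h x \<squnion>\<^bsub>M\<^esub> h y)"
      using xy by (simp_all add: mono'' M.join_left M.join_right hc)
    then have "x \<squnion>\<^bsub>L\<^esub> y \<sqsubseteq>\<^bsub>L\<^esub> k (h x \<squnion>\<^bsub>M\<^esub> h y)"
      using xy by (simp add: L.join_le kc hc)
    then show "h (x \<squnion>\<^bsub>L\<^esub> y) \<sqsubseteq>\<^bsub>M\<^esub> h x \<squnion>\<^bsub>M\<^esub> h y"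
      using xy mono[of "x \<squnion>\<^bsub>L\<^esub> y" "k (h x \<squnion>\<^bsub>M\<^esub> h y)"] by (simp add: hk hc kc)
    show "h x \<squnion>\<^bsub>M\<^esub> h y \<sqsubseteq>\<^bsub>M\<^esub> h (x \<squnion>\<^bsub>L\<^esub> y)"
      using xy by (intro M.join_le) (auto simp: mono[symmetric] hc L.join_left L.join_right)
  qed (use xy hc in auto)
  moreover have "h (x \<sqinter>\<^bsub>L\<^esub> y) = h x \<sqinter>\<^bsub>M\<^esub> h y" if xy: "x \<in> carrier L" "y \<in> carrier L" for x y
  proof (rule M.le_antisym)
    have "k (h x \<sqinter>\<^bsub>M\<^esub> h y) \<sqsubseteq>\<^bsub>L\<^esub> x" "k (h x \<sqinter>\<^bsub>M\<^esub> h y) \<sqsubseteq>\<^bsub>L\<^esub> y"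
      using xy by (simp_all add: mono' M.meet_left M.meet_right hc)
    then have "k (h x \<sqinter>\<^bsub>M\<^esub> h y) \<sqsubseteq>\<^bsub>L\<^esub> x \<sqinter>\<^bsub>L\<^esub> y"
      using xy by (simp add: L.meet_le kc hc)
    then show "h x \<sqinter>\<^bsub>M\<^esub> h y \<sqsubseteq>\<^bsub>M\<^esub> h (x \<sqinter>\<^bsub>L\<^esub> y)"
      using xy mono[of "k (h x \<sqinter>\<^bsub>M\<^esub> h y)" "x \<sqinter>\<^bsub>L\<^esub> y"] by (simp add: hk hc kc)
    show "h (x \<sqinter>\<^bsub>L\<^esub> y) \<sqsubseteq>\<^bsub>M\<^esub> h x \<sqinter>\<^bsub>M\<^esub> h y"
      using xy by (intro M.meet_le) (auto simp: mono[symmetric] hc L.meet_left L.meet_right)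
  qed (use xy hc in auto)
  moreover have "bij_betw h (carrier L) (carrier M)"
    by (rule bij_betw_byWitness[where f' = k]) (use hc kc hk kh in auto)
  ultimately show ?thesis
    using \<open>lattice L\<close> \<open>lattice M\<close> by (simp add: lattice_isos_def join_pres_def meet_pres_def)
qed

text \<open>Gives \<open>Con_system\<close> its lattice structure. Only the partial order is
  verified there directly; joins and meets are the images under \<open>h\<close> of those of the
  preimages, so no description of the join of two pairs \<open>(C, T)\<close> has to be
  found.\<close>

lemma order_iso_lattice:
  assumes "lattice L" "partial_order M"
    and h: "h \<in> carrier L \<rightarrow> carrier M" and k: "k \<in> carrier M \<rightarrow> carrier L"
    and kh: "\<And>x. x \<in> carrier L \<Longrightarrow> k (h x) = x" and hk: "\<And>y. y \<in> carrier M \<Longrightarrow> h (k y) = y"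
    and mono: "\<And>x y. x \<in> carrier L \<Longrightarrow> y \<in> carrier L \<Longrightarrow> x \<sqsubseteq>\<^bsub>L\<^esub> y \<longleftrightarrow> h x \<sqsubseteq>\<^bsub>M\<^esub> h y"
  shows "lattice M"
proof -
  interpret L: lattice L by fact
  interpret M: partial_order M by fact
  have hc: "\<And>x. x \<in> carrier L \<Longrightarrow> h x \<in> carrier M"
    and kc: "\<And>x. x \<in> carrier M \<Longrightarrow> k x \<in> carrier L" using h k by auto
  have kmono: "x \<sqsubseteq>\<^bsub>M\<^esub> y \<longleftrightarrow> k x \<sqsubseteq>\<^bsub>L\<^esub> k y" if "x \<in> carrier M" "y \<in> carrier M" for x y
    using mono[of "k x" "k y"] that kc hk by auto
  show ?thesis
  proof
    fix x y assume xy: "x \<in> carrier M" "y \<in> carrier M"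
    have "least M (h (k x \<squnion>\<^bsub>L\<^esub> k y)) (Upper M {x, y})"
      using xy by (auto simp: least_def Upper_def kmono kh kc hc L.join_left L.join_right L.join_le)
    then show "\<exists>s. least M s (Upper M {x, y})" ..
    have "greatest M (h (k x \<sqinter>\<^bsub>L\<^esub> k y)) (Lower M {x, y})"
      using xy by (auto simp: greatest_def Lower_def kmono kh kc hc L.meet_left L.meet_right L.meet_le)
    then show "\<exists>s. greatest M s (Lower M {x, y})" ..
  qed
qed

section \<open>The lattice of congruences of one algebra\<close>

lemma congruencesI:
  assumes "equiv (carrier A) \<theta>"
    and "\<And>g as bs. length as = ar g \<Longrightarrow> list_all2 (\<lambda>a b. (a, b) \<in> \<theta>) as bs \<Longrightarrow>
      (oper A g as, oper A g bs) \<in> \<theta>"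
  shows "\<theta> \<in> congruences ar A"
  using assms by (auto simp: congruences_def)

lemma
  assumes "\<theta> \<in> congruences ar A"
  shows congruences_carrier: "(a, b) \<in> \<theta> \<Longrightarrow> a \<in> carrier A \<and> b \<in> carrier A"
    and congruences_refl: "a \<in> carrier A \<Longrightarrow> (a, a) \<in> \<theta>"
    and congruences_sym: "(a, b) \<in> \<theta> \<Longrightarrow> (b, a) \<in> \<theta>"
    and congruences_trans: "(a, b) \<in> \<theta> \<Longrightarrow> (b, c) \<in> \<theta> \<Longrightarrow> (a, c) \<in> \<theta>"
    and congruences_oper: "length as = ar g \<Longrightarrow> list_all2 (\<lambda>a b. (a, b) \<in> \<theta>) as bs \<Longrightarrow>
      (oper A g as, oper A g bs) \<in> \<theta>"
  using assms unfolding congruences_def equiv_def refl_on_def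
  by (auto dest: symD transD)

lemma congruences_eval:
  assumes \<theta>: "\<theta> \<in> congruences ar A" and vw: "\<And>x. (v x, w x) \<in> \<theta>"
  shows "wf_trm ar t \<Longrightarrow> (eval_trm A v t, eval_trm A w t) \<in> \<theta>"
proof (induction t)
  case (Fn g ts)
  then show ?case
    by (auto intro!: congruences_oper[OF \<theta>] simp: list_all2_map1 list_all2_map2 list_all2_same)
qed (simp add: vw)

lemma full_congruence:
  assumes "is_algebra ar A"
  shows "carrier A \<times> carrier A \<in> congruences ar A"
proof (rule congruencesI)
  show "equiv (carrier A) (carrier A \<times> carrier A)"
    by (auto simp: equiv_def refl_on_def sym_def trans_def)
next
  fix g as bs
  assume l: "length as = ar g" "list_all2 (\<lambda>a b. (a, b) \<in> carrier A \<times> carrier A) as bs"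
  then have "set as \<subseteq> carrier A" "set bs \<subseteq> carrier A" "length bs = ar g"
    by (auto simp: list_all2_conv_all_nth in_set_conv_nth)
  with l show "(oper A g as, oper A g bs) \<in> carrier A \<times> carrier A"
    using assms by (auto simp: is_algebra_def)
qed

text \<open>\<open>R\<close> is non-empty because \<open>\<Inter>{}\<close> is the universal set,
  not a relation on the carrier; the empty family is served by
  \<open>full_congruence\<close>.\<close>

lemma Inter_congruences:
  assumes sub: "R \<subseteq> congruences ar A" and ne: "R \<noteq> {}"
  shows "\<Inter>R \<in> congruences ar A"
proof (rule congruencesI)
  obtain \<theta> where \<theta>: "\<theta> \<in> R" using ne by auto
  have c: "\<rho> \<in> congruences ar A" if "\<rho> \<in> R" for \<rho> using sub that by auto
  show "equiv (carrier A) (\<Inter>R)"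
    by (rule equivI) (use \<theta> c in \<open>auto simp: refl_on_def sym_def trans_def
        dest: congruences_carrier intro: congruences_refl congruences_sym\<close>,
        meson congruences_trans)
  fix g as bs
  assume l: "length as = ar g" "list_all2 (\<lambda>a b. (a, b) \<in> \<Inter>R) as bs"
  then show "(oper A g as, oper A g bs) \<in> \<Inter>R"
    by (auto intro!: congruences_oper[OF c] elim!: list_all2_mono)
qed

text \<open>Meets are intersections and there is a greatest congruence; joins then arise as meets of
  all upper bounds, without a description of generated congruences.\<close>

lemma lattice_Con_algebra:
  assumes "is_algebra ar A"
  shows "lattice (Con_algebra ar A)"
proof -
  interpret partial_order "Con_algebra ar A"
    by unfold_locales (auto simp: Con_algebra_def)
  have "complete_lattice (Con_algebra ar A)"
  proof (rule complete_lattice_criterion1)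
    have "greatest (Con_algebra ar A) (carrier A \<times> carrier A) (carrier (Con_algebra ar A))"
      using full_congruence[OF assms]
      by (auto simp: greatest_def Con_algebra_def dest: congruences_carrier)
    then show "\<exists>g. greatest (Con_algebra ar A) g (carrier (Con_algebra ar A))" ..
  next
    fix R assume R: "R \<subseteq> carrier (Con_algebra ar A)" "R \<noteq> {}"
    then have "greatest (Con_algebra ar A) (\<Inter>R) (Lower (Con_algebra ar A) R)"
      using Inter_congruences[of R ar A]
      by (auto simp: greatest_def Lower_def Con_algebra_def)
    then show "\<exists>i. greatest (Con_algebra ar A) i (Lower (Con_algebra ar A) R)" ..
  qed
  then interpret complete_lattice "Con_algebra ar A" .
  show ?thesis ..
qed


section \<open>The Plonka sum of a semilattice direct system\<close>

locale direct_system =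
  fixes ar :: "'f \<Rightarrow> nat" and I :: "'i gorder" (structure)
    and A :: "'i \<Rightarrow> ('a, 'f) algebra" and p :: "'i \<Rightarrow> 'i \<Rightarrow> 'a \<Rightarrow> 'a"
  assumes system: "semilattice_direct_system ar I A p"

sublocale direct_system \<subseteq> upper_semilattice I
  using system by (simp add: semilattice_direct_system_def)

context direct_system
begin

abbreviation P :: "('a, 'f) algebra" where "P \<equiv> plonka_sum I A p"

abbreviation ix :: "'a \<Rightarrow> 'i" where "ix \<equiv> index_of I A"

text \<open>The transition map with its source read off from the element, so that elements of the
  sum can be moved without naming their summands. It is meaningful when
  \<open>ix a \<sqsubseteq> j\<close>.\<close>

definition up :: "'i \<Rightarrow> 'a \<Rightarrow> 'a" where "up j a = p (ix a) j a"

lemma join_le_iff: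
  "x \<in> carrier I \<Longrightarrow> y \<in> carrier I \<Longrightarrow> z \<in> carrier I \<Longrightarrow> x \<squnion> y \<sqsubseteq> z \<longleftrightarrow> x \<sqsubseteq> z \<and> y \<sqsubseteq> z"
  by (meson join_closed join_le join_left join_right le_trans)

lemma le_joinI1: "x \<sqsubseteq> y \<Longrightarrow> x \<in> carrier I \<Longrightarrow> y \<in> carrier I \<Longrightarrow> z \<in> carrier I \<Longrightarrow> x \<sqsubseteq> y \<squnion> z"
  by (meson join_closed join_left le_trans)

lemma le_joinI2: "x \<sqsubseteq> z \<Longrightarrow> x \<in> carrier I \<Longrightarrow> y \<in> carrier I \<Longrightarrow> z \<in> carrier I \<Longrightarrow> x \<sqsubseteq> y \<squnion> z"
  by (meson join_closed join_right le_trans)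

lemma join_absorb: "x \<sqsubseteq> y \<Longrightarrow> x \<in> carrier I \<Longrightarrow> y \<in> carrier I \<Longrightarrow> x \<squnion> y = y"
  by (simp add: le_antisym join_le join_right)

lemma join_absorb2: "x \<sqsubseteq> y \<Longrightarrow> x \<in> carrier I \<Longrightarrow> y \<in> carrier I \<Longrightarrow> y \<squnion> x = y"
  using join_absorb join_comm by metis

lemma join_idem: "x \<in> carrier I \<Longrightarrow> x \<squnion> x = x"
  by (simp add: join_absorb)

lemma component_algebra: "i \<in> carrier I \<Longrightarrow> is_algebra ar (A i)"
  using system by (simp add: semilattice_direct_system_def)

lemma component_nonempty: "i \<in> carrier I \<Longrightarrow> carrier (A i) \<noteq> {}"
  using component_algebra by (simp add: is_algebra_def)

lemma component_oper_closed:
  "i \<in> carrier I \<Longrightarrow> set as \<subseteq> carrier (A i) \<Longrightarrow> length as = ar g \<Longrightarrow> oper (A i) g as \<in> carrier (A i)"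
  using component_algebra by (simp add: is_algebra_def)

lemma p_hom: "i \<in> carrier I \<Longrightarrow> j \<in> carrier I \<Longrightarrow> i \<sqsubseteq> j \<Longrightarrow> p i j \<in> algebra_hom ar (A i) (A j)"
  using system by (simp add: semilattice_direct_system_def)

lemma p_closed:
  "i \<in> carrier I \<Longrightarrow> j \<in> carrier I \<Longrightarrow> i \<sqsubseteq> j \<Longrightarrow> a \<in> carrier (A i) \<Longrightarrow> p i j a \<in> carrier (A j)"
  using p_hom by (auto simp: algebra_hom_def)

lemma p_oper:
  "i \<in> carrier I \<Longrightarrow> j \<in> carrier I \<Longrightarrow> i \<sqsubseteq> j \<Longrightarrow> set as \<subseteq> carrier (A i) \<Longrightarrow> length as = ar g \<Longrightarrow>
    p i j (oper (A i) g as) = oper (A j) g (map (p i j) as)"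
  using p_hom by (auto simp: algebra_hom_def)

lemma p_self: "i \<in> carrier I \<Longrightarrow> a \<in> carrier (A i) \<Longrightarrow> p i i a = a"
  using system by (simp add: semilattice_direct_system_def)

lemma p_comp:
  assumes "i \<in> carrier I" "j \<in> carrier I" "k \<in> carrier I" "i \<sqsubseteq> j" "j \<sqsubseteq> k" "a \<in> carrier (A i)"
  shows "p j k (p i j a) = p i k a"
proof -
  have "\<forall>i\<in>carrier I. \<forall>j\<in>carrier I. \<forall>k\<in>carrier I. i \<sqsubseteq> j \<and> j \<sqsubseteq> k \<longrightarrow>
        (\<forall>a\<in>carrier (A i). p i k a = p j k (p i j a))"
    using system unfolding semilattice_direct_system_def by (elim conjE) assumption
  from this[rule_format, of i j k a] assms show ?thesis by simp
qed

text \<open>Disjointness of the universes is what makes the definite description in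
  \<open>index_of\<close> denote.\<close>

lemma ix_eq:
  assumes "i \<in> carrier I" "a \<in> carrier (A i)"
  shows "ix a = i"
proof -
  have "\<forall>i\<in>carrier I. \<forall>j\<in>carrier I. i \<noteq> j \<longrightarrow> carrier (A i) \<inter> carrier (A j) = {}"
    using system by (simp add: semilattice_direct_system_def)
  with assms show ?thesis
    unfolding index_of_def by (intro the_equality) blast+
qed

section \<open>Elements, operations and terms of the sum\<close>

lemma carrier_P: "carrier P = (\<Union>i \<in> carrier I. carrier (A i))"
  by (simp add: plonka_sum_def)

lemma carrier_PI: "i \<in> carrier I \<Longrightarrow> a \<in> carrier (A i) \<Longrightarrow> a \<in> carrier P"
  by (auto simp: carrier_P)

lemma ix_closed: "a \<in> carrier P \<Longrightarrow> ix a \<in> carrier I"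
  by (auto simp: carrier_P ix_eq)

lemma in_component: "a \<in> carrier P \<Longrightarrow> a \<in> carrier (A (ix a))"
  by (auto simp: carrier_P ix_eq)

lemma up_closed: "a \<in> carrier P \<Longrightarrow> j \<in> carrier I \<Longrightarrow> ix a \<sqsubseteq> j \<Longrightarrow> up j a \<in> carrier (A j)"
  by (simp add: up_def p_closed ix_closed in_component)

lemma up_eq: "i \<in> carrier I \<Longrightarrow> a \<in> carrier (A i) \<Longrightarrow> up j a = p i j a"
  by (simp add: up_def ix_eq)

lemma up_self: "i \<in> carrier I \<Longrightarrow> a \<in> carrier (A i) \<Longrightarrow> up i a = a"
  by (simp add: up_eq p_self)

lemma up_up:
  "a \<in> carrier P \<Longrightarrow> j \<in> carrier I \<Longrightarrow> k \<in> carrier I \<Longrightarrow> ix a \<sqsubseteq> j \<Longrightarrow> j \<sqsubseteq> k \<Longrightarrow> up k (up j a) = up k a"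
  by (simp add: up_eq[OF _ up_closed]) (simp add: up_def p_comp ix_closed in_component)

text \<open>Treats constants and the other operations alike: in both cases the operation is computed
  at the least upper bound \<open>j\<close> of the indices of the arguments, the least element being
  the least upper bound of no indices at all.\<close>

lemma oper_P_ex:
  assumes as: "set as \<subseteq> carrier P" "length as = ar g"
  shows "\<exists>j \<in> carrier I. (\<forall>a \<in> set as. ix a \<sqsubseteq> j) \<and>
    (\<forall>k \<in> carrier I. (\<forall>a \<in> set as. ix a \<sqsubseteq> k) \<longrightarrow> j \<sqsubseteq> k) \<and>
    (as \<noteq> [] \<longrightarrow> j = \<Squnion>(ix ` set as)) \<and>
    oper P g as = oper (A j) g (map (up j) as)"
proof (cases "as = []")
  case True
  then have "ar g = 0" using as by simp
  moreover have "(\<exists>c. ar c = 0) \<longrightarrow> (\<exists>i0. least I i0 (carrier I))"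
    using system unfolding semilattice_direct_system_def by (elim conjE) assumption
  ultimately have "\<exists>i0. least I i0 (carrier I)" by blast
  \<comment> \<open>\<open>\<bottom>\<close> is a least element only if one exists. The system
    provides it, since \<open>as = []\<close> makes \<open>g\<close> a constant.\<close>
  then have "least I \<bottom> (carrier I)"
    by (intro weak_partial_order_bottom.bottom_least weak_partial_order_bottom.intro
        weak_partial_order_bottom_axioms.intro weak_partial_order_axioms)
  with True show ?thesis
    by (intro bexI[of _ "\<bottom>"]) (auto simp: plonka_sum_def least_def)
next
  case False
  let ?X = "ix ` set as"
  have l: "least I (\<Squnion>?X) (Upper I ?X)"
    using as False by (intro finite_sup_least) (auto intro: ix_closed)
  have "\<And>a. a \<in> set as \<Longrightarrow> ix a \<sqsubseteq> \<Squnion>?X"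
    using l as by (auto intro!: least_Upper_above ix_closed)
  moreover have "\<Squnion>?X \<sqsubseteq> k" if "k \<in> carrier I" "\<forall>a \<in> set as. ix a \<sqsubseteq> k" for k
    by (rule least_le[OF l]) (use that as in \<open>auto intro!: Upper_memI ix_closed\<close>)
  moreover have "oper P g as = oper (A (\<Squnion>?X)) g (map (up (\<Squnion>?X)) as)"
    using False by (simp add: plonka_sum_def Let_def up_def[abs_def])
  ultimately show ?thesis
    using l by (intro bexI[of _ "\<Squnion>?X"]) auto
qed

text \<open>\<open>up_oper\<close> is the main tool below: transition maps are homomorphisms, so an
  operation of the sum can be computed at any index above those of all its arguments, and two
  results can be compared at one common index.\<close>

lemma
  assumes as: "set as \<subseteq> carrier P" "length as = ar g"
  shows oper_P_closed: "oper P g as \<in> carrier P"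
    and ix_oper_upper: "a \<in> set as \<Longrightarrow> ix a \<sqsubseteq> ix (oper P g as)"
    and ix_oper_least: "k \<in> carrier I \<Longrightarrow> (\<And>a. a \<in> set as \<Longrightarrow> ix a \<sqsubseteq> k) \<Longrightarrow> ix (oper P g as) \<sqsubseteq> k"
    and ix_oper: "as \<noteq> [] \<Longrightarrow> ix (oper P g as) = \<Squnion>(ix ` set as)"
    and up_oper: "k \<in> carrier I \<Longrightarrow> (\<And>a. a \<in> set as \<Longrightarrow> ix a \<sqsubseteq> k) \<Longrightarrow>
      up k (oper P g as) = oper (A k) g (map (up k) as)"
proof -
  obtain j where j': "j \<in> carrier I" "\<forall>a \<in> set as. ix a \<sqsubseteq> j"
    "\<forall>k \<in> carrier I. (\<forall>a \<in> set as. ix a \<sqsubseteq> k) \<longrightarrow> j \<sqsubseteq> k"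
    "as \<noteq> [] \<longrightarrow> j = \<Squnion>(ix ` set as)"
    "oper P g as = oper (A j) g (map (up j) as)"
    using oper_P_ex[OF as] by (elim bexE conjE) (rule that)
  note j = j'(1) j'(2,3,4)[rule_format] j'(5)
  have sub: "set (map (up j) as) \<subseteq> carrier (A j)"
    using j as by (auto intro: up_closed)
  have c: "oper P g as \<in> carrier (A j)"
    unfolding j(5) using sub as by (intro component_oper_closed j(1)) auto
  then have ixj: "ix (oper P g as) = j" using j(1) ix_eq by blast
  show "oper P g as \<in> carrier P" using c j(1) carrier_PI by blast
  show "a \<in> set as \<Longrightarrow> ix a \<sqsubseteq> ix (oper P g as)" using ixj j by simp
  show "k \<in> carrier I \<Longrightarrow> (\<And>a. a \<in> set as \<Longrightarrow> ix a \<sqsubseteq> k) \<Longrightarrow> ix (oper P g as) \<sqsubseteq> k"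
    using ixj j by simp
  show "as \<noteq> [] \<Longrightarrow> ix (oper P g as) = \<Squnion>(ix ` set as)" using ixj j by simp
  assume k: "k \<in> carrier I" "\<And>a. a \<in> set as \<Longrightarrow> ix a \<sqsubseteq> k"
  then have jk: "j \<sqsubseteq> k" by (rule j(3))
  have "up k (oper P g as) = p j k (oper (A j) g (map (up j) as))"
    using c j(1) by (simp add: up_eq j(5)[symmetric])
  also have "\<dots> = oper (A k) g (map (p j k) (map (up j) as))"
    using sub as by (intro p_oper j(1) k(1) jk) auto
  also have "map (p j k) (map (up j) as) = map (up k) as"
    using as j k jk by (auto simp: up_eq[OF _ up_closed, symmetric] up_up subset_iff)
  finally show "up k (oper P g as) = oper (A k) g (map (up k) as)" .
qed

text \<open>\<open>as \<noteq> []\<close> matters: a constant of the sum lies in the least summand,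
  whatever \<open>i\<close> is.\<close>

lemma oper_P_component:
  assumes i: "i \<in> carrier I" and as: "set as \<subseteq> carrier (A i)" "length as = ar g" "as \<noteq> []"
  shows "oper P g as = oper (A i) g as"
proof -
  have asP: "set as \<subseteq> carrier P" using as i carrier_PI by blast
  have ix: "ix a = i" if "a \<in> set as" for a using that as i ix_eq by blast
  then have "ix ` set as = {i}" using as(3) by (auto simp: neq_Nil_conv)
  then have ixo: "ix (oper P g as) = i"
    using ix_oper[OF asP as(2,3)] i by (simp add: sup_of_singleton)
  have "oper P g as = up i (oper P g as)"
    using oper_P_closed[OF asP as(2)] ixo i up_self in_component by metis
  also have "\<dots> = oper (A i) g (map (up i) as)"
    using up_oper[OF asP as(2) i] ix i by simp
  also have "map (up i) as = as"
    using as i by (intro map_idI) (auto intro: up_self)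
  finally show ?thesis .
qed

lemma is_algebra_P: "is_algebra ar P"
proof -
  have "carrier I \<noteq> {}" using system by (simp add: semilattice_direct_system_def)
  then have "carrier P \<noteq> {}" using component_nonempty by (auto simp: carrier_P)
  then show ?thesis by (auto simp: is_algebra_def intro: oper_P_closed)
qed

text \<open>The index clauses place the value of a term exactly at the join of the indices of the
  variables occurring in it. The join is expressed by bounds, which also covers terms without
  variables. The last clause is \<open>up_oper\<close> for terms.\<close>

lemma eval_P:
  assumes v: "\<And>x. v x \<in> carrier P"
  shows "wf_trm ar t \<Longrightarrow> eval_trm P v t \<in> carrier P \<and> (\<forall>x \<in> vars t. ix (v x) \<sqsubseteq> ix (eval_trm P v t)) \<and>
    (\<forall>k \<in> carrier I. (\<forall>x \<in> vars t. ix (v x) \<sqsubseteq> k) \<longrightarrow>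
       ix (eval_trm P v t) \<sqsubseteq> k \<and> up k (eval_trm P v t) = eval_trm (A k) (\<lambda>x. up k (v x)) t)"
proof (induction t)
  case (Var x)
  then show ?case using v by (simp add: ix_closed)
next
  case (Fn g ts)
  let ?as = "map (eval_trm P v) ts"
  have IH: "eval_trm P v t \<in> carrier P" "\<And>x. x \<in> vars t \<Longrightarrow> ix (v x) \<sqsubseteq> ix (eval_trm P v t)"
    "\<And>k. k \<in> carrier I \<Longrightarrow> (\<And>x. x \<in> vars t \<Longrightarrow> ix (v x) \<sqsubseteq> k) \<Longrightarrow>
       ix (eval_trm P v t) \<sqsubseteq> k \<and> up k (eval_trm P v t) = eval_trm (A k) (\<lambda>x. up k (v x)) t"
    if "t \<in> set ts" for t
    using Fn that by auto
  have as: "set ?as \<subseteq> carrier P" "length ?as = ar g" using Fn IH by auto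
  have c: "oper P g ?as \<in> carrier P" using oper_P_closed[OF as] .
  moreover have "ix (v x) \<sqsubseteq> ix (oper P g ?as)" if "t \<in> set ts" "x \<in> vars t" for t x
  proof -
    have "ix (eval_trm P v t) \<sqsubseteq> ix (oper P g ?as)" using that by (intro ix_oper_upper[OF as]) auto
    then show ?thesis using IH(1,2) that c v by (meson ix_closed le_trans)
  qed
  moreover have "ix (oper P g ?as) \<sqsubseteq> k \<and> up k (oper P g ?as) = eval_trm (A k) (\<lambda>x. up k (v x)) (Fn g ts)"
    if k: "k \<in> carrier I" "\<forall>x \<in> vars (Fn g ts). ix (v x) \<sqsubseteq> k" for k
  proof -
    have t: "ix (eval_trm P v t) \<sqsubseteq> k" "up k (eval_trm P v t) = eval_trm (A k) (\<lambda>x. up k (v x)) t"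
      if "t \<in> set ts" for t using IH(3)[OF that k(1)] k(2) that by auto
    have "\<And>a. a \<in> set ?as \<Longrightarrow> ix a \<sqsubseteq> k" using t by auto
    then show ?thesis
      using ix_oper_least[OF as k(1)] up_oper[OF as k(1)] t(2)
      by (simp add: comp_def cong: map_cong)
  qed
  ultimately show ?case by auto
qed

section \<open>From congruences on the system to congruences on the sum\<close>

text \<open>\<open>system_congruence_up\<close> is condition (iii) for
  \<open>i \<sqsubseteq> j\<close>, where the join of \<open>i\<close> and \<open>j\<close> is
  \<open>j\<close>. \<open>system_congruence_down\<close> is the inclusion of (iv) that does not
  follow from (iii); \<open>c\<close> and \<open>d\<close> witness that \<open>(i, j)\<close> lies
  in \<open>S_of I A p C T\<close>.\<close>

lemma
  assumes "(C, T) \<in> system_congruences ar I A p"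
  shows system_congruence_equiv: "equiv (carrier I) C"
    and system_congruence_join: "(i, j) \<in> C \<Longrightarrow> (k, l) \<in> C \<Longrightarrow> (i \<squnion> k, j \<squnion> l) \<in> C"
    and system_congruence_component: "i \<in> carrier I \<Longrightarrow> T i \<in> congruences ar (A i)"
    and system_congruence_up: "i \<in> carrier I \<Longrightarrow> j \<in> carrier I \<Longrightarrow> i \<sqsubseteq> j \<Longrightarrow>
      (a, b) \<in> T i \<Longrightarrow> (p i j a, p i j b) \<in> T j"
    and system_congruence_down: "(i, j) \<in> C \<Longrightarrow> c \<in> carrier (A i) \<Longrightarrow> d \<in> carrier (A j) \<Longrightarrow>
      (p i (i \<squnion> j) c, p j (i \<squnion> j) d) \<in> T (i \<squnion> j) \<Longrightarrow> a \<in> carrier (A i) \<Longrightarrow> b \<in> carrier (A i) \<Longrightarrow>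
      (p i (i \<squnion> j) a, p i (i \<squnion> j) b) \<in> T (i \<squnion> j) \<Longrightarrow> (a, b) \<in> T i"
proof -
  have C: "C \<in> join_congruences I"
    and T: "\<And>i. i \<in> carrier I \<Longrightarrow> T i \<in> congruences ar (A i)"
    and sub: "\<And>i j. i \<in> carrier I \<Longrightarrow> j \<in> carrier I \<Longrightarrow> T i \<subseteq> pullback A p i i (i \<squnion> j) (T (i \<squnion> j))"
    and eq: "\<And>i j. (i, j) \<in> S_of I A p C T \<Longrightarrow> T i = pullback A p i i (i \<squnion> j) (T (i \<squnion> j))"
    using assms by (auto simp: system_congruences_def)
  show "equiv (carrier I) C" using C by (simp add: join_congruences_def)
  show "(i, j) \<in> C \<Longrightarrow> (k, l) \<in> C \<Longrightarrow> (i \<squnion> k, j \<squnion> l) \<in> C"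
    using C by (auto simp: join_congruences_def)
  show "i \<in> carrier I \<Longrightarrow> T i \<in> congruences ar (A i)" by (rule T)
  show "(p i j a, p i j b) \<in> T j"
    if "i \<in> carrier I" "j \<in> carrier I" "i \<sqsubseteq> j" "(a, b) \<in> T i"
    using sub[of i j] that by (auto simp: pullback_def join_absorb)
  show "(a, b) \<in> T i"
    if "(i, j) \<in> C" "c \<in> carrier (A i)" "d \<in> carrier (A j)"
      "(p i (i \<squnion> j) c, p j (i \<squnion> j) d) \<in> T (i \<squnion> j)" "a \<in> carrier (A i)" "b \<in> carrier (A i)"
      "(p i (i \<squnion> j) a, p i (i \<squnion> j) b) \<in> T (i \<squnion> j)"
  proof -
    have "(c, d) \<in> pullback A p i j (i \<squnion> j) (T (i \<squnion> j))" using that by (simp add: pullback_def)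
    then have "(i, j) \<in> S_of I A p C T" using that(1) by (auto simp: S_of_def)
    from eq[OF this] show ?thesis using that by (auto simp: pullback_def)
  qed
qed

text \<open>The case distinctions in \<open>from_system\<close> dissolve: a pair of \<open>C\<close>
  outside \<open>S_of I A p C T\<close> has an empty pullback and adds nothing, and on the diagonal
  the pullback along identity maps is \<open>T i\<close>. What is left is a test on
  elements.\<close>

lemma from_system_iff:
  assumes "(C, T) \<in> system_congruences ar I A p"
  shows "(a, b) \<in> from_system I A p (C, T) \<longleftrightarrow> a \<in> carrier P \<and> b \<in> carrier P \<and> (ix a, ix b) \<in> C \<and>
    (up (ix a \<squnion> ix b) a, up (ix a \<squnion> ix b) b) \<in> T (ix a \<squnion> ix b)"
proof -
  note C = system_congruence_equiv[OF assms] and T = system_congruence_component[OF assms]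
  have CI: "i \<in> carrier I" "j \<in> carrier I" if "(i, j) \<in> C" for i j
    using C that by (auto dest: equiv_type)
  have diag: "T i = pullback A p i i (i \<squnion> i) (T (i \<squnion> i))" if "i \<in> carrier I" for i
    using that congruences_carrier[OF T[OF that]] by (auto simp: pullback_def join_idem p_self)
  have cond: "(if i = j then T i else pullback A p i j (i \<squnion> j) (T (i \<squnion> j))) =
      pullback A p i j (i \<squnion> j) (T (i \<squnion> j))" if "(i, j) \<in> C" for i j
    by (metis CI(1) diag that)
  have "from_system I A p (C, T) = (\<Union>(i, j) \<in> S_of I A p C T. pullback A p i j (i \<squnion> j) (T (i \<squnion> j)))"
    unfolding from_system_def prod.case
    by (rule SUP_cong) (clarsimp simp: S_of_def cond)+
  also have "\<dots> = (\<Union>(i, j) \<in> C. pullback A p i j (i \<squnion> j) (T (i \<squnion> j)))"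
    by (auto simp: S_of_def)
  also have "(a, b) \<in> \<dots> \<longleftrightarrow> a \<in> carrier P \<and> b \<in> carrier P \<and> (ix a, ix b) \<in> C \<and>
    (up (ix a \<squnion> ix b) a, up (ix a \<squnion> ix b) b) \<in> T (ix a \<squnion> ix b)" (is "?L \<longleftrightarrow> ?R")
  proof
    assume ?L
    then obtain i j where ij: "(i, j) \<in> C" "a \<in> carrier (A i)" "b \<in> carrier (A j)"
      "(p i (i \<squnion> j) a, p j (i \<squnion> j) b) \<in> T (i \<squnion> j)"
      by (auto simp: pullback_def)
    note I = CI[OF ij(1)]
    show ?R using ij I
      by (simp add: ix_eq[OF I(1) ij(2)] ix_eq[OF I(2) ij(3)] up_def carrier_PI[OF I(1) ij(2)]
          carrier_PI[OF I(2) ij(3)])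
  next
    assume ?R
    then show ?L
      by (intro UN_I[of "(ix a, ix b)"]) (simp_all add: pullback_def up_def in_component)
  qed
  finally show ?thesis .
qed

lemma sup_insert:
  assumes xX: "x \<in> carrier I" "X \<subseteq> carrier I" "finite X" "X \<noteq> {}"
  shows "\<Squnion>(insert x X) = x \<squnion> \<Squnion>X"
proof -
  have l: "least I (\<Squnion>X) (Upper I X)" using finite_sup_least xX by blast
  have l': "least I (\<Squnion>(insert x X)) (Upper I (insert x X))"
    using finite_sup_least xX by blast
  have m: "\<Squnion>X \<in> carrier I" "\<Squnion>(insert x X) \<in> carrier I" using l l' by blast+
  show ?thesis
  proof (rule le_antisym)
    show "\<Squnion>(insert x X) \<sqsubseteq> x \<squnion> \<Squnion>X"
    proof (rule least_le[OF l'], rule Upper_memI)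
      fix y assume "y \<in> insert x X"
      then consider "y = x" | "y \<in> X" by blast
      then show "y \<sqsubseteq> x \<squnion> \<Squnion>X"
      proof cases
        case 1
        then show ?thesis using join_left[OF xX(1) m(1)] by simp
      next
        case 2
        show ?thesis
          using least_Upper_above[OF l 2 xX(2)] 2 xX(1,2) m(1) by (intro le_joinI2) blast+
      qed
    qed (use m xX in auto)
    have "\<Squnion>X \<sqsubseteq> \<Squnion>(insert x X)"
      using m xX by (intro least_le[OF l] Upper_memI) (simp_all add: least_Upper_above[OF l'])
    moreover have "x \<sqsubseteq> \<Squnion>(insert x X)"
      using xX by (intro least_Upper_above[OF l']) auto
    ultimately show "x \<squnion> \<Squnion>X \<sqsubseteq> \<Squnion>(insert x X)"
      using m xX by (simp add: join_le)
  qed (use m xX in auto)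
qed

text \<open>\<open>join_congruences\<close> speaks of binary joins, whereas an operation joins the
  indices of all its arguments at once; induction on the two lists bridges this.\<close>

lemma join_congruence_sup:
  assumes C: "\<And>i j k l. (i, j) \<in> C \<Longrightarrow> (k, l) \<in> C \<Longrightarrow> (i \<squnion> k, j \<squnion> l) \<in> C" "C \<subseteq> carrier I \<times> carrier I"
  shows "list_all2 (\<lambda>i j. (i, j) \<in> C) is js \<Longrightarrow> is \<noteq> [] \<Longrightarrow> (\<Squnion>(set is), \<Squnion>(set js)) \<in> C"
proof (induction rule: list_all2_induct)
  case (Cons i "is" j js)
  have ij: "i \<in> carrier I" "j \<in> carrier I" using Cons.hyps(1) C by auto
  show ?case
  proof (cases "is = []")
    case True
    then have "js = []" using Cons.hyps(2) by simp
    then show ?thesis using True Cons.hyps(1) ij by (simp add: sup_of_singleton)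
  next
    case False
    then have ne: "js \<noteq> []" using Cons.hyps(2) by auto
    have sub: "set is \<subseteq> carrier I" "set js \<subseteq> carrier I"
      using Cons.hyps(2) C(2) by (fastforce simp: list_all2_conv_all_nth in_set_conv_nth)+
    show ?thesis
      using sup_insert[of i "set is"] sup_insert[of j "set js"] ij sub False ne Cons C(1) by simp
  qed
qed simp

text \<open>Compatibility with operations only moves relations up, by (iii). Transitivity is the one
  place where a relation has to come down, by (iv).\<close>

lemma from_system_congruence:
  assumes CT: "(C, T) \<in> system_congruences ar I A p"
  shows "from_system I A p (C, T) \<in> congruences ar P"
proof -
  note C = system_congruence_equiv[OF CT] and Cj = system_congruence_join[OF CT]
    and T = system_congruence_component[OF CT] and Tup = system_congruence_up[OF CT]
    and Tdown = system_congruence_down[OF CT]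
  have CI: "C \<subseteq> carrier I \<times> carrier I" using C by (rule equiv_type)
  have Csym: "\<And>i j. (i, j) \<in> C \<Longrightarrow> (j, i) \<in> C" and Crefl: "\<And>i. i \<in> carrier I \<Longrightarrow> (i, i) \<in> C"
    and Ctrans: "\<And>i j k. (i, j) \<in> C \<Longrightarrow> (j, k) \<in> C \<Longrightarrow> (i, k) \<in> C"
    using C by (meson equivE symD, meson equivE refl_onD, meson equivE transD)
  let ?\<theta> = "from_system I A p (C, T)"
  note iff = from_system_iff[OF CT]
  have Tup': "(up k a, up k b) \<in> T k"
    if "a \<in> carrier P" "b \<in> carrier P" "(up j a, up j b) \<in> T j" "ix a \<sqsubseteq> j" "ix b \<sqsubseteq> j" "j \<sqsubseteq> k"
      "j \<in> carrier I" "k \<in> carrier I" for a b j k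
    using Tup[OF that(7,8,6,3)] that by (simp add: up_eq[OF _ up_closed, symmetric] up_up)
  show ?thesis
  proof (rule congruencesI)
    show "equiv (carrier P) ?\<theta>"
    proof (rule equivI)
      show "?\<theta> \<subseteq> carrier P \<times> carrier P" by (auto simp: iff)
      show "refl_on (carrier P) ?\<theta>"
        by (auto simp: refl_on_def iff Crefl ix_closed join_idem up_closed intro!: congruences_refl[OF T])
      show "sym ?\<theta>"
      proof (rule symI)
        fix a b assume "(a, b) \<in> ?\<theta>"
        then show "(b, a) \<in> ?\<theta>"
          by (auto simp: iff join_comm[of _ "ix b"] ix_closed Csym intro!: congruences_sym[OF T])
      qed
      show "trans ?\<theta>"
      proof (rule transI)
        fix a b c assume ab: "(a, b) \<in> ?\<theta>" and bc: "(b, c) \<in> ?\<theta>"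
        let ?i = "ix a" and ?j = "ix b" and ?k = "ix c"
        let ?m = "?i \<squnion> ?k" let ?n = "?m \<squnion> ?j"
        have P: "a \<in> carrier P" "b \<in> carrier P" "c \<in> carrier P" using ab bc by (auto simp: iff)
        note ixc = P[THEN ix_closed]
        have Cs: "(?i, ?j) \<in> C" "(?j, ?k) \<in> C" using ab bc by (auto simp: iff)
        have le: "?i \<sqsubseteq> ?m" "?k \<sqsubseteq> ?m" "?m \<sqsubseteq> ?n" "?i \<sqsubseteq> ?n" "?j \<sqsubseteq> ?n" "?k \<sqsubseteq> ?n"
          using ixc by (auto intro: le_joinI1 join_left join_right)
        have n: "?n \<in> carrier I" "?m \<in> carrier I" using ixc by auto
        have 1: "(up ?n a, up ?n b) \<in> T ?n"
          by (rule Tup'[of _ _ "?i \<squnion> ?j"])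
            (use ab ixc P le in \<open>auto simp: iff join_le join_left join_right\<close>)
        have 2: "(up ?n b, up ?n c) \<in> T ?n"
          by (rule Tup'[of _ _ "?j \<squnion> ?k"])
            (use bc ixc P le in \<open>auto simp: iff join_le join_left join_right\<close>)
        have 3: "(up ?n a, up ?n c) \<in> T ?n" using congruences_trans[OF T[OF n(1)] 1 2] .
        \<comment> \<open>Condition (iv) at \<open>(?m, ?j)\<close>, witnessed by \<open>(a, b)\<close>, descends from \<open>T ?n\<close> to \<open>T ?m\<close>.\<close>
        have "(?m, ?j \<squnion> ?j) \<in> C" using Cj[OF Cs(1) Csym[OF Cs(2)]] .
        then have mj: "(?m, ?j) \<in> C" using ixc by (simp add: join_idem)
        have pm: "p ?m ?n (up ?m x) = up ?n x" if "x \<in> carrier P" "ix x \<sqsubseteq> ?m" for x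
          using that le n up_up[of x ?m ?n] by (simp add: up_eq[OF _ up_closed, symmetric])
        have "(up ?m a, up ?m c) \<in> T ?m"
          by (rule Tdown[OF mj, of "up ?m a" b])
            (use P le n 1 3 in \<open>auto simp: pm up_closed in_component up_def[of _ b, symmetric]\<close>)
        then show "(a, c) \<in> ?\<theta>" using P Ctrans[OF Cs] by (simp add: iff)
      qed
    qed
  next
    fix g as bs
    assume l: "length as = ar g" "list_all2 (\<lambda>a b. (a, b) \<in> ?\<theta>) as bs"
    then have lb: "length bs = ar g" by (auto dest: list_all2_lengthD)
    have asP: "set as \<subseteq> carrier P" and bsP: "set bs \<subseteq> carrier P"
      using l(2) by (fastforce simp: list_all2_conv_all_nth in_set_conv_nth iff)+
    let ?a = "oper P g as" and ?b = "oper P g bs"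
    have P: "?a \<in> carrier P" "?b \<in> carrier P" using oper_P_closed asP bsP l lb by auto
    let ?n = "ix ?a \<squnion> ix ?b"
    note ixc = P[THEN ix_closed]
    have n: "?n \<in> carrier I" using ixc by simp
    have lea: "ix x \<sqsubseteq> ?n" if "x \<in> set as" for x
      using ix_oper_upper[OF asP l(1) that] that asP ixc by (auto intro!: le_joinI1 ix_closed)
    have leb: "ix x \<sqsubseteq> ?n" if "x \<in> set bs" for x
      using ix_oper_upper[OF bsP lb that] that bsP ixc by (auto intro!: le_joinI2 ix_closed)
    have "(ix ?a, ix ?b) \<in> C"
    proof (cases "as = []")
      case True
      then show ?thesis using l(2) Crefl ixc by simp
    next
      case False
      have "list_all2 (\<lambda>i j. (i, j) \<in> C) (map ix as) (map ix bs)"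
        using l(2) by (auto simp: list_all2_map1 list_all2_map2 iff elim!: list_all2_mono)
      from join_congruence_sup[OF Cj CI this] False
      have "(\<Squnion>(ix ` set as), \<Squnion>(ix ` set bs)) \<in> C" by simp
      moreover have "bs \<noteq> []" using l False by auto
      ultimately show ?thesis using ix_oper[OF asP l(1)] ix_oper[OF bsP lb] False by simp
    qed
    \<comment> \<open>\<open>?n\<close> lies above the indices of all entries of both lists, so both
      results, moved to \<open>?n\<close>, are values of the operation of the single algebra
      \<open>A ?n\<close>, of which \<open>T ?n\<close> is a congruence.\<close>
    moreover have "(oper (A ?n) g (map (up ?n) as), oper (A ?n) g (map (up ?n) bs)) \<in> T ?n"
    proof (rule congruences_oper[OF T[OF n]])
      show "length (map (up ?n) as) = ar g" using l by simp
      have "(up ?n x, up ?n y) \<in> T ?n" if "(x, y) \<in> ?\<theta>" "x \<in> set as" "y \<in> set bs" for x y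
        by (rule Tup'[of _ _ "ix x \<squnion> ix y"])
          (use that lea leb n in \<open>auto simp: iff ix_closed join_le join_left join_right\<close>)
      then show "list_all2 (\<lambda>a b. (a, b) \<in> T ?n) (map (up ?n) as) (map (up ?n) bs)"
        using l(2) by (auto simp: list_all2_conv_all_nth)
    qed
    ultimately show "(?a, ?b) \<in> ?\<theta>"
      using P up_oper[OF asP l(1) n lea] up_oper[OF bsP lb n leb] by (simp add: iff)
  qed
qed

text \<open>For \<open>i \<sqsubseteq> j\<close>, a pair of \<open>C\<close> is witnessed in
  \<open>S_theta\<close> by any \<open>a\<close> and its image \<open>p i j a\<close>, since
  \<open>T j\<close> is reflexive. Arbitrary pairs reduce to this case: as \<open>C\<close> respects
  joins, \<open>(i, j) \<in> C\<close> exactly when both indices are congruent to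
  \<open>i \<squnion> j\<close>.\<close>

lemma to_from_system:
  assumes CT: "(C, T) \<in> system_congruences ar I A p"
  shows "to_system I A (from_system I A p (C, T)) = (C, T)"
proof -
  note C = system_congruence_equiv[OF CT] and Cj = system_congruence_join[OF CT]
    and T = system_congruence_component[OF CT]
  have Text: "T \<in> extensional (carrier I)" using CT by (simp add: system_congruences_def)
  have CI: "C \<subseteq> carrier I \<times> carrier I" using C by (rule equiv_type)
  have Csym: "\<And>i j. (i, j) \<in> C \<Longrightarrow> (j, i) \<in> C" and Crefl: "\<And>i. i \<in> carrier I \<Longrightarrow> (i, i) \<in> C"
    and Ctrans: "\<And>i j k. (i, j) \<in> C \<Longrightarrow> (j, k) \<in> C \<Longrightarrow> (i, k) \<in> C"
    using C by (meson equivE symD, meson equivE refl_onD, meson equivE transD)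
  let ?\<theta> = "from_system I A p (C, T)"
  note iff = from_system_iff[OF CT]
  have S: "(i, j) \<in> S_theta I A ?\<theta> \<longleftrightarrow> (i, j) \<in> C"
    if ij: "i \<in> carrier I" "j \<in> carrier I" "i \<sqsubseteq> j" for i j
  proof
    assume "(i, j) \<in> S_theta I A ?\<theta>"
    then show "(i, j) \<in> C" using ij by (auto simp: S_theta_def component_def iff ix_eq)
  next
    assume Cij: "(i, j) \<in> C"
    obtain a where a: "a \<in> carrier (A i)" using component_nonempty ij by auto
    let ?b = "p i j a"
    have b: "?b \<in> carrier (A j)" using a ij p_closed by simp
    have "up j ?b = ?b" "up j a = ?b" using a b ij by (simp_all add: up_self up_eq)
    then have "(a, ?b) \<in> ?\<theta>"
      using a b ij Cij congruences_refl[OF T]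
      by (simp add: iff ix_eq[OF _ a] ix_eq[OF _ b] carrier_PI[OF _ a] carrier_PI[OF _ b] join_absorb)
    then show "(i, j) \<in> S_theta I A ?\<theta>" using a b ij by (auto simp: S_theta_def component_def)
  qed
  have "(i, j) \<in> C_theta I A ?\<theta> \<longleftrightarrow> (i, j) \<in> C" for i j
  proof
    assume "(i, j) \<in> C_theta I A ?\<theta>"
    then have "(i, i \<squnion> j) \<in> C" "(j, i \<squnion> j) \<in> C"
      by (auto simp: C_theta_def S join_left join_right)
    then show "(i, j) \<in> C" using Csym Ctrans by blast
  next
    assume ij: "(i, j) \<in> C"
    then have ijI: "i \<in> carrier I" "j \<in> carrier I" using CI by auto
    have "(i \<squnion> i, i \<squnion> j) \<in> C" "(j \<squnion> j, i \<squnion> j) \<in> C" using ij ijI Cj Crefl Csym by blast+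
    then show "(i, j) \<in> C_theta I A ?\<theta>"
      using ijI by (auto simp: C_theta_def S join_left join_right join_idem)
  qed
  then have "C_theta I A ?\<theta> = C" by auto
  moreover have "component A ?\<theta> i i = T i" if i: "i \<in> carrier I" for i
    using i congruences_carrier[OF T[OF i]] Crefl[OF i]
    by (auto simp: component_def iff ix_eq[OF i] join_idem up_self carrier_PI)
  then have "(\<lambda>i \<in> carrier I. component A ?\<theta> i i) = T"
    using Text by (intro extensionalityI[of _ "carrier I"]) auto
  ultimately show ?thesis by (simp add: to_system_def)
qed

end

section \<open>From congruences on the sum to congruences on the system\<close>

text \<open>All that is kept of the variety is one witnessing term and the identity it satisfies in
  every summand.\<close>

locale irregular_direct_system = direct_system ar I A p
  for ar :: "'f \<Rightarrow> nat" and I :: "'i gorder" (structure)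
    and A :: "'i \<Rightarrow> ('a, 'f) algebra" and p :: "'i \<Rightarrow> 'i \<Rightarrow> 'a \<Rightarrow> 'a" +
  fixes t :: "'f trm"
  assumes t: "wf_trm ar t" "vars t = {0, 1}"
    and t_first: "\<And>i. i \<in> carrier I \<Longrightarrow> satisfies (A i) t (Var 0)"
begin

text \<open>On the sum, the term \<open>t(a, b)\<close> does not forget \<open>b\<close>: it moves \<open>a\<close> to the join of the two indices.\<close>

definition shift :: "'a \<Rightarrow> 'a \<Rightarrow> 'a" where
  "shift a b = up (ix a \<squnion> ix b) a"

lemma eval_shift:
  assumes ab: "a \<in> carrier P" "b \<in> carrier P"
  shows "eval_trm P (\<lambda>x. if x = 1 then b else a) t = shift a b"
proof -
  \<comment> \<open>Every variable other than 1 receives \<open>a\<close>, so that all values of the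
    valuation lie in the sum, as \<open>eval_P\<close> requires; \<open>t\<close> sees only 0 and
    1.\<close>
  let ?v = "\<lambda>x::nat. if x = 1 then b else a" and ?j = "ix a \<squnion> ix b"
  note I = ab[THEN ix_closed]
  have j: "?j \<in> carrier I" using I by simp
  have le: "ix (?v x) \<sqsubseteq> ?j" for x using I by (simp add: join_left join_right)
  have "?v x \<in> carrier P" for x using ab by simp
  note E = eval_P[OF this t(1)]
  let ?e = "eval_trm P ?v t"
  have e: "?e \<in> carrier P" using E by (rule conjunct1)
  have "ix ?e \<sqsubseteq> ?j \<and> up ?j ?e = eval_trm (A ?j) (\<lambda>x. up ?j (?v x)) t"
    by (rule E[THEN conjunct2, THEN conjunct2, rule_format, OF j le])
  then have E1: "ix ?e \<sqsubseteq> ?j" "up ?j ?e = eval_trm (A ?j) (\<lambda>x. up ?j (?v x)) t"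
    by (rule conjunct1, rule conjunct2)
  have E2: "\<forall>x \<in> vars t. ix (?v x) \<sqsubseteq> ix ?e" by (rule E[THEN conjunct2, THEN conjunct1])
  \<comment> \<open>Both variables occur in \<open>t\<close>. This forces the index of the value up
    to the join, although inside every summand the value of \<open>t\<close> does not depend on its
    second argument.\<close>
  have "ix a \<sqsubseteq> ix ?e" "ix b \<sqsubseteq> ix ?e" using bspec[OF E2, of 0] bspec[OF E2, of 1] t(2) by simp_all
  then have "?j \<sqsubseteq> ix ?e" using I ix_closed[OF e] by (simp add: join_le)
  then have "ix ?e = ?j" using E1(1) j ix_closed[OF e] by (simp add: le_antisym)
  then have "?e = up ?j ?e" using up_self[OF j, of ?e] in_component[OF e] by simp
  also have "\<dots> = eval_trm (A ?j) (\<lambda>x. up ?j (?v x)) (Var 0)"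
    unfolding E1(2)
  proof (rule t_first[OF j, unfolded satisfies_def, rule_format])
    show "range (\<lambda>x. up ?j (?v x)) \<subseteq> carrier (A ?j)"
      using ab j I by (auto intro!: up_closed join_left join_right)
  qed
  finally show ?thesis by (simp add: shift_def)
qed

lemma shift_congruence:
  assumes \<theta>: "\<theta> \<in> congruences ar P" and "(a, a') \<in> \<theta>" "(b, b') \<in> \<theta>"
  shows "(shift a b, shift a' b') \<in> \<theta>"
proof -
  have "(eval_trm P (\<lambda>x. if x = 1 then b else a) t, eval_trm P (\<lambda>x. if x = 1 then b' else a') t) \<in> \<theta>"
    by (rule congruences_eval[OF \<theta> _ t(1)]) (use assms in auto)
  then show ?thesis using congruences_carrier[OF \<theta>] assms(2,3)
    by (simp add: eval_shift del: One_nat_def)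
qed

lemma shift_apply:
  "i \<in> carrier I \<Longrightarrow> j \<in> carrier I \<Longrightarrow> a \<in> carrier (A i) \<Longrightarrow> b \<in> carrier (A j) \<Longrightarrow> shift a b = p i (i \<squnion> j) a"
  by (simp add: shift_def up_def ix_eq)

lemma shift_eq:
  "i \<in> carrier I \<Longrightarrow> j \<in> carrier I \<Longrightarrow> i \<sqsubseteq> j \<Longrightarrow> a \<in> carrier (A i) \<Longrightarrow> b \<in> carrier (A j) \<Longrightarrow> shift a b = p i j a"
  by (simp add: shift_apply join_absorb)

text \<open>Shifting by an element at a lower index has no effect. Applied to a related pair,
  \<open>shift\<close> can thus hold one entry in place while \<open>shift_eq\<close> or
  \<open>shift_apply\<close> moves the other.\<close>

lemma shift_same:
  "i \<in> carrier I \<Longrightarrow> j \<in> carrier I \<Longrightarrow> j \<sqsubseteq> i \<Longrightarrow> a \<in> carrier (A i) \<Longrightarrow> b \<in> carrier (A j) \<Longrightarrow> shift a b = a"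
  by (simp add: shift_apply join_absorb2 p_self)

section \<open>Index pairs linked by a congruence of the sum\<close>

context
  fixes \<theta> assumes \<theta>: "\<theta> \<in> congruences ar P"
begin

lemma S_theta_related:
  assumes im: "(i, m) \<in> S_theta I A \<theta>" "i \<sqsubseteq> m" and a: "a \<in> carrier (A i)"
  shows "(a, p i m a) \<in> \<theta>"
proof -
  obtain c d where cd: "i \<in> carrier I" "m \<in> carrier I" "c \<in> carrier (A i)" "d \<in> carrier (A m)" "(c, d) \<in> \<theta>"
    using im by (auto simp: S_theta_def component_def)
  have "(shift a c, shift a d) \<in> \<theta>"
    using cd a by (intro shift_congruence[OF \<theta>] congruences_refl[OF \<theta>]) (auto intro: carrier_PI)
  then show ?thesis using cd a im by (simp add: shift_eq[of i m] shift_same[of i i])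
qed

lemma S_thetaI:
  "i \<in> carrier I \<Longrightarrow> m \<in> carrier I \<Longrightarrow> a \<in> carrier (A i) \<Longrightarrow> b \<in> carrier (A m) \<Longrightarrow> (a, b) \<in> \<theta> \<Longrightarrow>
    (i, m) \<in> S_theta I A \<theta>"
  by (auto simp: S_theta_def component_def)

lemma S_theta_carrier: "(i, m) \<in> S_theta I A \<theta> \<Longrightarrow> i \<in> carrier I \<and> m \<in> carrier I"
  by (simp add: S_theta_def)

lemma S_theta_refl: "i \<in> carrier I \<Longrightarrow> (i, i) \<in> S_theta I A \<theta>"
  by (metis S_thetaI carrier_PI component_nonempty congruences_refl[OF \<theta>] ex_in_conv)

lemma S_theta_trans:
  assumes "(i, j) \<in> S_theta I A \<theta>" "(j, k) \<in> S_theta I A \<theta>" "i \<sqsubseteq> j" "j \<sqsubseteq> k"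
  shows "(i, k) \<in> S_theta I A \<theta>"
proof -
  have I: "i \<in> carrier I" "j \<in> carrier I" "k \<in> carrier I" using assms S_theta_carrier by auto
  obtain a where a: "a \<in> carrier (A i)" using component_nonempty I by auto
  have b: "p i j a \<in> carrier (A j)" using a I assms by (simp add: p_closed)
  have "(a, p i j a) \<in> \<theta>" "(p i j a, p j k (p i j a)) \<in> \<theta>"
    using S_theta_related assms a b by blast+
  then have "(a, p j k (p i j a)) \<in> \<theta>" by (rule congruences_trans[OF \<theta>])
  then show ?thesis using a b I assms by (auto intro!: S_thetaI p_closed)
qed

text \<open>Take \<open>a\<close> at \<open>i \<squnion> k\<close> and shift it by \<open>c\<close>
  at \<open>i\<close> and by the related element \<open>p i m c\<close> at \<open>m\<close>. The
  first shift leaves \<open>a\<close> alone; the second moves it to the join with \<open>m\<close>,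
  which is \<open>m \<squnion> k\<close> because \<open>i \<sqsubseteq> m\<close>.\<close>

lemma S_theta_join:
  assumes "(i, m) \<in> S_theta I A \<theta>" "i \<sqsubseteq> m" and k: "k \<in> carrier I"
  shows "(i \<squnion> k, m \<squnion> k) \<in> S_theta I A \<theta>"
proof -
  have I: "i \<in> carrier I" "m \<in> carrier I" using assms S_theta_carrier by auto
  let ?n = "(i \<squnion> k) \<squnion> m"
  have n: "?n = m \<squnion> k"
    using I k assms(2) by (intro le_antisym) (simp_all add: join_le_iff join_left join_right le_joinI1 le_joinI2)
  obtain a where a: "a \<in> carrier (A (i \<squnion> k))" using component_nonempty[of "i \<squnion> k"] I k by auto
  obtain c where c: "c \<in> carrier (A i)" using component_nonempty I by auto
  have d: "p i m c \<in> carrier (A m)" using c I assms by (simp add: p_closed)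
  have "(shift a c, shift a (p i m c)) \<in> \<theta>"
    using a c I k S_theta_related[OF assms(1,2) c]
    by (intro shift_congruence[OF \<theta>] congruences_refl[OF \<theta>]) (auto intro!: carrier_PI[of "i \<squnion> k"])
  moreover have "shift a c = a"
    by (rule shift_same[of "i \<squnion> k" i]) (use a c I k in \<open>auto intro: join_left\<close>)
  moreover have "shift a (p i m c) = p (i \<squnion> k) (m \<squnion> k) a"
    using shift_apply[of "i \<squnion> k" m, OF _ _ a d] I k by (simp add: n)
  moreover have "p (i \<squnion> k) (m \<squnion> k) a \<in> carrier (A (m \<squnion> k))"
    by (rule p_closed[OF _ _ _ a])
      (use I k assms(2) in \<open>simp_all add: join_le_iff join_right le_joinI1\<close>)
  ultimately show ?thesis using a I k by (auto intro!: S_thetaI)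
qed

text \<open>Shifting the related pair \<open>a\<close>, \<open>p i m a\<close> by an element at
  \<open>l\<close> moves the first entry to \<open>p i l a\<close> and fixes the second, since
  \<open>l \<sqsubseteq> m\<close>. Hence \<open>a\<close> and \<open>p i l a\<close> are both
  related to \<open>p i m a\<close>.\<close>

lemma S_theta_between:
  assumes im: "(i, m) \<in> S_theta I A \<theta>" and l: "l \<in> carrier I" "i \<sqsubseteq> l" "l \<sqsubseteq> m"
  shows "(i, l) \<in> S_theta I A \<theta>"
proof -
  have I: "i \<in> carrier I" "m \<in> carrier I" using im S_theta_carrier by auto
  have le: "i \<sqsubseteq> m" using I l le_trans by blast
  obtain a where a: "a \<in> carrier (A i)" using component_nonempty I by auto
  have d: "p i l a \<in> carrier (A l)" and e: "p i m a \<in> carrier (A m)"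
    using a I l le by (simp_all add: p_closed)
  have am: "(a, p i m a) \<in> \<theta>" using S_theta_related[OF im le a] .
  have "(shift a (p i l a), shift (p i m a) (p i l a)) \<in> \<theta>"
    using am d l by (intro shift_congruence[OF \<theta>] congruences_refl[OF \<theta>]) (auto intro: carrier_PI)
  moreover have "shift a (p i l a) = p i l a" "shift (p i m a) (p i l a) = p i m a"
    using shift_eq[OF I(1) l(1,2) a d] shift_same[OF I(2) l(1,3) e d] by auto
  ultimately have "(p i l a, p i m a) \<in> \<theta>" by simp
  then have "(a, p i l a) \<in> \<theta>" using am congruences_sym[OF \<theta>] congruences_trans[OF \<theta>] by blast
  then show ?thesis using a d I l by (auto intro: S_thetaI)
qed

text \<open>By \<open>S_theta_between\<close>, links to a common upper bound descend to the join, so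
  any common upper bound may serve in place of the join.\<close>

lemma C_thetaI:
  assumes "(i, k) \<in> S_theta I A \<theta>" "(j, k) \<in> S_theta I A \<theta>" "i \<sqsubseteq> k" "j \<sqsubseteq> k"
  shows "(i, j) \<in> C_theta I A \<theta>"
proof -
  have I: "i \<in> carrier I" "j \<in> carrier I" "k \<in> carrier I" using assms S_theta_carrier by auto
  then have "i \<squnion> j \<sqsubseteq> k" using assms by (simp add: join_le)
  then show ?thesis
    using I S_theta_between[OF assms(1)] S_theta_between[OF assms(2)]
    by (simp add: C_theta_def join_left join_right)
qed

lemma C_thetaE:
  assumes "(i, j) \<in> C_theta I A \<theta>"
  obtains k where "(i, k) \<in> S_theta I A \<theta>" "(j, k) \<in> S_theta I A \<theta>" "i \<sqsubseteq> k" "j \<sqsubseteq> k"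
    "i \<in> carrier I" "j \<in> carrier I" "k \<in> carrier I"
  using assms join_left join_right join_closed by (auto simp: C_theta_def)

lemma C_theta_join_congruence: "C_theta I A \<theta> \<in> join_congruences I"
proof -
  \<comment> \<open>Joining the link from \<open>j\<close> to \<open>l\<close> with \<open>k\<close>
    gives a link from \<open>k\<close> to \<open>k \<squnion> l\<close>, which continues the link
    from \<open>i\<close> to \<open>k\<close>. This is the core of transitivity.\<close>
  have common: "(i, k \<squnion> l) \<in> S_theta I A \<theta>" if "(i, k) \<in> S_theta I A \<theta>" "(j, k) \<in> S_theta I A \<theta>"
    "(j, l) \<in> S_theta I A \<theta>" "i \<sqsubseteq> k" "j \<sqsubseteq> k" "j \<sqsubseteq> l" for i j k l
  proof -
    have I: "i \<in> carrier I" "j \<in> carrier I" "k \<in> carrier I" "l \<in> carrier I"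
      using that S_theta_carrier by auto
    have "(j \<squnion> k, l \<squnion> k) \<in> S_theta I A \<theta>" by (rule S_theta_join) (use that I in auto)
    then have "(k, k \<squnion> l) \<in> S_theta I A \<theta>" using that I by (simp add: join_absorb join_comm[of _ l])
    then show ?thesis using S_theta_trans[OF that(1)] that I by (simp add: join_left)
  qed
  have refl: "(i, i) \<in> C_theta I A \<theta>" if "i \<in> carrier I" for i
    using that S_theta_refl by (intro C_thetaI[of i i i]) auto
  have sym: "(j, i) \<in> C_theta I A \<theta>" if "(i, j) \<in> C_theta I A \<theta>" for i j
    using C_thetaE[OF that] C_thetaI by metis
  have trans: "(i, l) \<in> C_theta I A \<theta>"
    if ij: "(i, j) \<in> C_theta I A \<theta>" and jl: "(j, l) \<in> C_theta I A \<theta>" for i j l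
  proof -
    obtain k where k: "(i, k) \<in> S_theta I A \<theta>" "(j, k) \<in> S_theta I A \<theta>" "i \<sqsubseteq> k" "j \<sqsubseteq> k"
      "i \<in> carrier I" "j \<in> carrier I" "k \<in> carrier I" using C_thetaE[OF ij] .
    obtain m where m: "(j, m) \<in> S_theta I A \<theta>" "(l, m) \<in> S_theta I A \<theta>" "j \<sqsubseteq> m" "l \<sqsubseteq> m"
      "j \<in> carrier I" "l \<in> carrier I" "m \<in> carrier I" using C_thetaE[OF jl] .
    have "(i, k \<squnion> m) \<in> S_theta I A \<theta>" using common k m by blast
    moreover have "(l, k \<squnion> m) \<in> S_theta I A \<theta>" using common[of l m j k] k m by (simp add: join_comm)
    ultimately show ?thesis
      by (rule C_thetaI) (use k m in \<open>auto intro: le_joinI1 le_joinI2\<close>)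
  qed
  \<comment> \<open>One factor at a time: \<open>i\<close> is raised to \<open>k\<close> beside
    \<open>i'\<close>, then \<open>i'\<close> to \<open>k'\<close> beside \<open>k\<close>.\<close>
  have step: "(i \<squnion> i', k \<squnion> k') \<in> S_theta I A \<theta>" if "(i, k) \<in> S_theta I A \<theta>" "(i', k') \<in> S_theta I A \<theta>"
    "i \<sqsubseteq> k" "i' \<sqsubseteq> k'" for i i' k k'
  proof -
    have I: "i \<in> carrier I" "i' \<in> carrier I" "k \<in> carrier I" "k' \<in> carrier I"
      using that S_theta_carrier by auto
    have "(i \<squnion> i', k \<squnion> i') \<in> S_theta I A \<theta>" using S_theta_join that I by blast
    moreover have "(k \<squnion> i', k \<squnion> k') \<in> S_theta I A \<theta>"
      using S_theta_join[OF that(2,4) I(3)] by (simp add: join_comm)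
    ultimately show ?thesis
      by (rule S_theta_trans) (use I that in \<open>simp_all add: join_le_iff join_left join_right le_joinI1 le_joinI2\<close>)
  qed
  have join: "(i \<squnion> i', j \<squnion> j') \<in> C_theta I A \<theta>"
    if ij: "(i, j) \<in> C_theta I A \<theta>" and ij': "(i', j') \<in> C_theta I A \<theta>" for i j i' j'
  proof -
    obtain k where k: "(i, k) \<in> S_theta I A \<theta>" "(j, k) \<in> S_theta I A \<theta>" "i \<sqsubseteq> k" "j \<sqsubseteq> k"
      "i \<in> carrier I" "j \<in> carrier I" "k \<in> carrier I" using C_thetaE[OF ij] .
    obtain m where m: "(i', m) \<in> S_theta I A \<theta>" "(j', m) \<in> S_theta I A \<theta>" "i' \<sqsubseteq> m" "j' \<sqsubseteq> m"
      "i' \<in> carrier I" "j' \<in> carrier I" "m \<in> carrier I" using C_thetaE[OF ij'] .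
    show ?thesis
      by (rule C_thetaI[OF step[OF k(1) m(1) k(3) m(3)] step[OF k(2) m(2) k(4) m(4)]])
        (use k m in \<open>simp_all add: join_le_iff le_joinI1 le_joinI2\<close>)
  qed
  have "C_theta I A \<theta> \<subseteq> carrier I \<times> carrier I" by (auto simp: C_theta_def)
  then have "equiv (carrier I) (C_theta I A \<theta>)"
    using refl sym trans by (intro equivI refl_onI symI transI) blast+
  then show ?thesis using join by (simp add: join_congruences_def)
qed

section \<open>Restrictions to the summands, and recovery of the congruence from them\<close>

lemma C_theta_up:
  assumes "(i, j) \<in> C_theta I A \<theta>"
  shows "a \<in> carrier (A i) \<Longrightarrow> (a, p i (i \<squnion> j) a) \<in> \<theta>" "b \<in> carrier (A j) \<Longrightarrow> (b, p j (i \<squnion> j) b) \<in> \<theta>"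
  using assms S_theta_related by (auto simp: C_theta_def join_left join_right)

lemma component_congruence:
  assumes i: "i \<in> carrier I"
  shows "component A \<theta> i i \<in> congruences ar (A i)"
proof (rule congruencesI)
  show "equiv (carrier (A i)) (component A \<theta> i i)"
    using congruences_refl[OF \<theta> carrier_PI[OF i]] congruences_sym[OF \<theta>] congruences_trans[OF \<theta>]
    unfolding component_def by (intro equivI refl_onI symI transI) blast+
  fix g as bs
  assume l: "length as = ar g" "list_all2 (\<lambda>a b. (a, b) \<in> component A \<theta> i i) as bs"
  then have lb: "length bs = ar g" by (auto dest: list_all2_lengthD)
  have sub: "set as \<subseteq> carrier (A i)" "set bs \<subseteq> carrier (A i)"
    using l(2) by (fastforce simp: list_all2_conv_all_nth in_set_conv_nth component_def)+
  have c: "oper (A i) g as \<in> carrier (A i)" "oper (A i) g bs \<in> carrier (A i)"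
    using sub l lb i by (auto intro: component_oper_closed)
  have "(oper (A i) g as, oper (A i) g bs) \<in> \<theta>"
  proof (cases "as = []")
    \<comment> \<open>A constant of the sum is in general not the constant of \<open>A i\<close>, so
      the congruence of the sum cannot be applied to it. But both lists are empty here and
      reflexivity suffices.\<close>
    case True
    then show ?thesis using l(2) congruences_refl[OF \<theta> carrier_PI[OF i c(1)]] by simp
  next
    case False
    then have "bs \<noteq> []" using l by auto
    moreover have "(oper P g as, oper P g bs) \<in> \<theta>"
      by (rule congruences_oper[OF \<theta> l(1)])
        (use l(2) in \<open>auto simp: component_def elim!: list_all2_mono\<close>)
    ultimately show ?thesis
      using oper_P_component[OF i sub(1) l(1)] oper_P_component[OF i sub(2) lb] False by simp
  qed
  then show "(oper (A i) g as, oper (A i) g bs) \<in> component A \<theta> i i"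
    using c by (simp add: component_def)
qed

text \<open>Shifting both entries by the same \<open>d\<close> at \<open>j\<close> moves them
  together, whether or not \<open>\<theta>\<close> links \<open>i\<close> to
  \<open>j\<close>.\<close>

lemma component_up:
  assumes "i \<in> carrier I" "j \<in> carrier I" "i \<sqsubseteq> j" "(a, b) \<in> component A \<theta> i i"
  shows "(p i j a, p i j b) \<in> component A \<theta> j j"
proof -
  obtain d where d: "d \<in> carrier (A j)" using component_nonempty assms(2) by auto
  have ab: "a \<in> carrier (A i)" "b \<in> carrier (A i)" "(a, b) \<in> \<theta>"
    using assms by (auto simp: component_def)
  have "(shift a d, shift b d) \<in> \<theta>"
    using ab d assms by (intro shift_congruence[OF \<theta>] congruences_refl[OF \<theta>]) (auto intro: carrier_PI)
  then show ?thesis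
    using ab d assms by (simp add: component_def shift_eq[of i j] p_closed)
qed

lemma to_system_congruence: "to_system I A \<theta> \<in> system_congruences ar I A p"
proof -
  let ?T = "\<lambda>i \<in> carrier I. component A \<theta> i i"
  have sub: "?T i \<subseteq> pullback A p i i (i \<squnion> j) (?T (i \<squnion> j))" if "i \<in> carrier I" "j \<in> carrier I" for i j
  proof (rule subrelI)
    fix a b assume "(a, b) \<in> ?T i"
    then show "(a, b) \<in> pullback A p i i (i \<squnion> j) (?T (i \<squnion> j))"
      using that component_up[of i "i \<squnion> j" a b] by (auto simp: pullback_def join_left component_def)
  qed
  \<comment> \<open>Condition (iv), along the chain from \<open>a\<close> to its image, to the image
    of \<open>b\<close>, to \<open>b\<close>: on \<open>C_theta\<close> each element is related to
    its image at the join, and the two images are related by assumption.\<close>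
  moreover have "pullback A p i i (i \<squnion> j) (?T (i \<squnion> j)) \<subseteq> ?T i"
    if ij: "(i, j) \<in> C_theta I A \<theta>" for i j
  proof (rule subrelI)
    fix a b assume "(a, b) \<in> pullback A p i i (i \<squnion> j) (?T (i \<squnion> j))"
    moreover have i: "i \<in> carrier I" "j \<in> carrier I" using ij by (auto simp: C_theta_def)
    ultimately have ab: "a \<in> carrier (A i)" "b \<in> carrier (A i)"
      and "(p i (i \<squnion> j) a, p i (i \<squnion> j) b) \<in> \<theta>"
      by (simp_all add: pullback_def component_def)
    then have "(a, p i (i \<squnion> j) b) \<in> \<theta>"
      using congruences_trans[OF \<theta> C_theta_up(1)[OF ij]] by simp
    moreover have "(p i (i \<squnion> j) b, b) \<in> \<theta>"
      using congruences_sym[OF \<theta> C_theta_up(1)[OF ij ab(2)]] .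
    ultimately have "(a, b) \<in> \<theta>" by (rule congruences_trans[OF \<theta>])
    then show "(a, b) \<in> ?T i" using ab i by (simp add: component_def)
  qed
  moreover have "i \<in> carrier I \<and> j \<in> carrier I \<and> (i, j) \<in> C_theta I A \<theta>"
    if "(i, j) \<in> S_of I A p (C_theta I A \<theta>) ?T" for i j
    using that by (auto simp: S_of_def C_theta_def)
  ultimately have "\<forall>(i, j) \<in> S_of I A p (C_theta I A \<theta>) ?T. ?T i = pullback A p i i (i \<squnion> j) (?T (i \<squnion> j))"
    by blast
  then show ?thesis
    unfolding to_system_def system_congruences_def
    using C_theta_join_congruence component_congruence sub by (simp del: restrict_apply) simp
qed

lemma from_to_system: "from_system I A p (to_system I A \<theta>) = \<theta>"
proof -
  have CT: "(C_theta I A \<theta>, \<lambda>i \<in> carrier I. component A \<theta> i i) \<in> system_congruences ar I A p"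
    using to_system_congruence by (simp add: to_system_def)
  note iff = from_system_iff[OF CT, folded to_system_def]
  have "(a, b) \<in> from_system I A p (to_system I A \<theta>) \<longleftrightarrow> (a, b) \<in> \<theta>" for a b
  proof
    assume "(a, b) \<in> from_system I A p (to_system I A \<theta>)"
    then have ab: "a \<in> carrier P" "b \<in> carrier P" "(ix a, ix b) \<in> C_theta I A \<theta>"
      "(up (ix a \<squnion> ix b) a, up (ix a \<squnion> ix b) b) \<in> component A \<theta> (ix a \<squnion> ix b) (ix a \<squnion> ix b)"
      by (auto simp: iff ix_closed)
    then have up: "(up (ix a \<squnion> ix b) a, up (ix a \<squnion> ix b) b) \<in> \<theta>" by (simp add: component_def)
    have "(a, up (ix a \<squnion> ix b) a) \<in> \<theta>" "(b, up (ix a \<squnion> ix b) b) \<in> \<theta>"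
      using C_theta_up[OF ab(3)] ab(1,2) in_component by (auto simp: up_def)
    then show "(a, b) \<in> \<theta>"
      using up congruences_sym[OF \<theta>] congruences_trans[OF \<theta>] by blast
  next
    assume ab: "(a, b) \<in> \<theta>"
    then have P: "a \<in> carrier P" "b \<in> carrier P" using congruences_carrier[OF \<theta>] by auto
    note I = P[THEN ix_closed] and c = P[THEN in_component]
    let ?j = "ix a \<squnion> ix b"
    have j: "?j \<in> carrier I" using I by simp
    have le: "ix a \<sqsubseteq> ?j" "ix b \<sqsubseteq> ?j" using I by (auto intro: join_left join_right)
    \<comment> \<open>The indices of \<open>a\<close> and \<open>b\<close> may be incomparable.
      Shifting each element by both members of the pair relates it to its own image at the join, as
      \<open>shift a a\<close> is \<open>a\<close>.\<close>
    have "(shift a a, shift a b) \<in> \<theta>" "(shift b a, shift b b) \<in> \<theta>"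
      using shift_congruence[OF \<theta>] ab congruences_refl[OF \<theta>] P by blast+
    then have rel: "(a, up ?j a) \<in> \<theta>" "(b, up ?j b) \<in> \<theta>"
      using shift_same[OF I(1) I(1) _ c(1) c(1)] shift_same[OF I(2) I(2) _ c(2) c(2)]
        congruences_sym[OF \<theta>] I
      by (auto simp: shift_def join_comm)
    have u: "up ?j a \<in> carrier (A ?j)" "up ?j b \<in> carrier (A ?j)"
      using P j le by (auto intro: up_closed)
    have "(ix a, ix b) \<in> C_theta I A \<theta>"
      by (rule C_thetaI[of _ ?j]) (use rel u c I j le in \<open>auto intro: S_thetaI\<close>)
    moreover have "(up ?j a, up ?j b) \<in> \<theta>"
      using rel ab congruences_sym[OF \<theta>] congruences_trans[OF \<theta>] by blast
    ultimately show "(a, b) \<in> from_system I A p (to_system I A \<theta>)"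
      using P u j by (simp add: iff component_def)
  qed
  then show ?thesis by auto
qed

end

section \<open>Comparison of the two orders, and the isomorphism\<close>

lemma to_system_mono_iff:
  assumes \<theta>: "\<theta> \<in> congruences ar P" and \<eta>: "\<eta> \<in> congruences ar P"
  shows "\<theta> \<subseteq> \<eta> \<longleftrightarrow> to_system I A \<theta> \<sqsubseteq>\<^bsub>Con_system ar I A p\<^esub> to_system I A \<eta>"
proof
  assume "\<theta> \<subseteq> \<eta>"
  then have "component A \<theta> i j \<subseteq> component A \<eta> i j" for i j by (auto simp: component_def)
  then show "to_system I A \<theta> \<sqsubseteq>\<^bsub>Con_system ar I A p\<^esub> to_system I A \<eta>"
    by (auto simp: Con_system_def to_system_def C_theta_def S_theta_def)
next
  assume "to_system I A \<theta> \<sqsubseteq>\<^bsub>Con_system ar I A p\<^esub> to_system I A \<eta>"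
  then have C: "C_theta I A \<theta> \<subseteq> C_theta I A \<eta>"
    and T: "\<And>i. i \<in> carrier I \<Longrightarrow> component A \<theta> i i \<subseteq> component A \<eta> i i"
    by (auto simp: Con_system_def to_system_def)
  \<comment> \<open>Every congruence of the sum is recovered from its pair by
    \<open>from_to_system\<close>, and the resulting membership test is monotone in
    \<open>C_theta\<close> and in the restrictions. This yields reflection of the order.\<close>
  have iff: "(a, b) \<in> \<rho> \<longleftrightarrow> a \<in> carrier P \<and> b \<in> carrier P \<and> (ix a, ix b) \<in> C_theta I A \<rho> \<and>
    (up (ix a \<squnion> ix b) a, up (ix a \<squnion> ix b) b) \<in> component A \<rho> (ix a \<squnion> ix b) (ix a \<squnion> ix b)"
    if \<rho>: "\<rho> \<in> congruences ar P" for \<rho> a b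
    using from_system_iff[OF to_system_congruence[OF \<rho>, unfolded to_system_def], of a b]
    by (auto simp: from_to_system[OF \<rho>, unfolded to_system_def] ix_closed)
  show "\<theta> \<subseteq> \<eta>"
  proof (rule subrelI)
    fix a b assume "(a, b) \<in> \<theta>"
    then show "(a, b) \<in> \<eta>"
      unfolding iff[OF \<theta>] iff[OF \<eta>] using C T[of "ix a \<squnion> ix b"] by (auto simp: ix_closed)
  qed
qed

text \<open>Antisymmetry is the delicate clause: the order compares families on the index set only,
  and extensionality settles their values elsewhere.\<close>

lemma partial_order_Con_system: "partial_order (Con_system ar I A p)"
proof
  fix x y
  assume xy: "x \<in> carrier (Con_system ar I A p)" "y \<in> carrier (Con_system ar I A p)"
    "x \<sqsubseteq>\<^bsub>Con_system ar I A p\<^esub> y" "y \<sqsubseteq>\<^bsub>Con_system ar I A p\<^esub> x"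
  obtain C T C' T' where eq: "x = (C, T)" "y = (C', T')" by fastforce
  have "T \<in> extensional (carrier I)" "T' \<in> extensional (carrier I)"
    using xy eq by (auto simp: Con_system_def system_congruences_def)
  moreover have "T i = T' i" if "i \<in> carrier I" for i
    using xy eq that by (auto simp: Con_system_def)
  ultimately have "T = T'" by (rule extensionalityI)
  then show "x .=\<^bsub>Con_system ar I A p\<^esub> y" using xy eq by (auto simp: Con_system_def)
qed (fastforce simp: Con_system_def)+

end

theorem theorem10:
  fixes ar :: "'f \<Rightarrow> nat"
    and V :: "('a, 'f) algebra set"
    and I :: "'i gorder"
    and A :: "'i \<Rightarrow> ('a, 'f) algebra"
    and p :: "'i \<Rightarrow> 'i \<Rightarrow> 'a \<Rightarrow> 'a"
  assumes "plural ar"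
    and "variety ar V"
    and "strongly_irregular ar V"
    and "semilattice_direct_system ar I A p"
    and "\<forall>i \<in> carrier I. A i \<in> V"
  shows "lattice (Con_algebra ar (plonka_sum I A p))
    \<and> lattice (Con_system ar I A p)
    \<and> (\<exists>h. h \<in> lattice_isos (Con_algebra ar (plonka_sum I A p)) (Con_system ar I A p))
    \<and> (\<forall>\<theta> \<in> congruences ar (plonka_sum I A p). to_system I A \<theta> \<in> system_congruences ar I A p)
    \<and> (\<forall>(C, T) \<in> system_congruences ar I A p.
          from_system I A p (C, T) \<in> congruences ar (plonka_sum I A p))
    \<and> to_system I A \<in> lattice_isos (Con_algebra ar (plonka_sum I A p)) (Con_system ar I A p)
    \<and> from_system I A p \<in> lattice_isos (Con_system ar I A p) (Con_algebra ar (plonka_sum I A p))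
    \<and> (\<forall>\<theta> \<in> congruences ar (plonka_sum I A p). from_system I A p (to_system I A \<theta>) = \<theta>)
    \<and> (\<forall>(C, T) \<in> system_congruences ar I A p.
          to_system I A (from_system I A p (C, T)) = (C, T))"
proof -
  obtain t where t: "wf_trm ar t" "vars t = {0, 1}" "\<And>B. B \<in> V \<Longrightarrow> satisfies B t (Var 0)"
    using assms(3) unfolding strongly_irregular_def by blast
  interpret irregular_direct_system ar I A p t
    by unfold_locales (use assms t in auto)
  let ?L = "Con_algebra ar P" and ?M = "Con_system ar I A p"
  let ?h = "to_system I A" and ?k = "from_system I A p"
  have L: "lattice ?L" using is_algebra_P by (rule lattice_Con_algebra)
  have h: "?h \<in> carrier ?L \<rightarrow> carrier ?M"
    using to_system_congruence by (auto simp: Con_algebra_def Con_system_def)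
  have k: "?k \<in> carrier ?M \<rightarrow> carrier ?L"
    using from_system_congruence by (auto simp: Con_algebra_def Con_system_def)
  have kh: "?k (?h \<theta>) = \<theta>" if "\<theta> \<in> carrier ?L" for \<theta>
    using that from_to_system by (simp add: Con_algebra_def)
  have hk: "?h (?k y) = y" if "y \<in> carrier ?M" for y
    using that to_from_system by (cases y) (simp add: Con_system_def)
  have mono: "\<theta> \<sqsubseteq>\<^bsub>?L\<^esub> \<eta> \<longleftrightarrow> ?h \<theta> \<sqsubseteq>\<^bsub>?M\<^esub> ?h \<eta>" if "\<theta> \<in> carrier ?L" "\<eta> \<in> carrier ?L" for \<theta> \<eta>
    using that to_system_mono_iff by (simp add: Con_algebra_def)
  have mono': "x \<sqsubseteq>\<^bsub>?M\<^esub> y \<longleftrightarrow> ?k x \<sqsubseteq>\<^bsub>?L\<^esub> ?k y" if "x \<in> carrier ?M" "y \<in> carrier ?M" for x y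
    using mono[of "?k x" "?k y"] that k hk by (auto simp: Pi_iff)
  \<comment> \<open>\<open>lattice_isos\<close> speaks of joins and meets in \<open>?M\<close>; this
    transport along \<open>?h\<close> establishes that they exist.\<close>
  have M: "lattice ?M" using order_iso_lattice[OF L partial_order_Con_system h k kh hk mono] .
  have h_iso: "?h \<in> lattice_isos ?L ?M" using order_iso_in_lattice_isos[OF L M h k kh hk mono] .
  have k_iso: "?k \<in> lattice_isos ?M ?L" using order_iso_in_lattice_isos[OF M L k h hk kh mono'] .
  show ?thesis
    using L M h_iso k_iso to_system_congruence from_system_congruence from_to_system to_from_system
    by blast
qed

end
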